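(* Let $(Y_n,\Gamma_n)_{n\in\mathbb{N}_0}$, $Y_n=(X_n,\phi_n)$, be an AIR MCMC chain with parameter $\beta\ge1$ in the setting described in the context. Assume that there exist $\tau\in[0,1)$ and $\Lambda\in(0,\infty)$ such that for all $\gamma\in\mathcal{I}$, $y\in\mathcal{Y}$ and $\ell\in\mathbb{N}$, $$\|P_\gamma^\ell(y,\cdot)-\pi_\gamma\|_{tv}\le\Lambda\tau^\ell .$$ Let $f\colon\mathcal{X}\to\mathbb{R}$ be measurable and bounded and let $\varepsilon>0$. Then there exists a measurable function $C\colon\Omega\to\mathbb{R}$ such that for $\mathbb{P}$-almost all $\omega\in\Omega$ and any $n\in\mathbb{N}$, $$\left|\frac1n\sum_{j=1}^n\bigl(f(X_j(\omega))-\nu(f)\bigr)\right|\le\frac{(\log n)^{1/2+\varepsilon}}{\sqrt n}\,C(\omega).$$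
   Context: Setting. $(\mathcal{X},\mathcal{F}_\mathcal{X},\nu)$ is a probability space, $(\Phi,\mathcal{F}_\Phi)$ is a measurable space, and $\mathcal{Y}=\mathcal{X}\times\Phi$ with $\mathcal{F}_\mathcal{Y}=\mathcal{F}_\mathcal{X}\otimes\mathcal{F}_\Phi$. $(\mathcal{I},\mathcal{F}_\mathcal{I})$ is a measurable space. All involved spaces are assumed to be Polish with (countably generated) Borel $\sigma$-algebras. $\{\pi_\gamma\}_{\gamma\in\mathcal{I}}$ is a family of probability measures on $\mathcal{Y}$ and $\{P_\gamma\}_{\gamma\in\mathcal{I}}$ a family of transition kernels on $\mathcal{Y}$ such that for every $\gamma$: $\pi_\gamma(B\times\Phi)=\nu(B)$ for all $B\in\mathcal{F}_\mathcal{X}$; $\pi_\gamma$ is the invariant distribution of $P_\gamma$; $P_\gamma$ is $\psi$-irreducible and aperiodic. Moreover $(y,\gamma)\mapsto P_\gamma(y,A)$ is measurable for every $A\in\mathcal{F}_\mathcal{Y}$. Write $\nu(f)=\int f\,d\nu$. AIR (adaptive increasingly rare) MCMC chain with parameter $\beta>0$. Put $k_j=\lceil j^\beta\rceil$, $T_0=0$, $T_m=\sum_{j=1}^m k_j$. The chain is a process $(Y_n,\Gamma_n)_{n\in\mathbb{N}_0}$ on a probability space $(\Omega,\mathcal{F},\mathbb{P})$ with values in $\mathcal{Y}\times\mathcal{I}$ such that: $(Y_0,\Gamma_0)=(y_0,\gamma_0)$ is deterministic; with $\mathcal{F}_n=\sigma(Y_0,\dots,Y_n,\Gamma_0,\dots,\Gamma_n)$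 one has $\mathbb{P}[Y_{n+1}\in B\mid\mathcal{F}_n]=P_{\Gamma_n}(Y_n,B)$ a.s. for all $B\in\mathcal{F}_\mathcal{Y}$; $\Gamma_n=U_n(Y_0,\dots,Y_n,\Gamma_0,\dots,\Gamma_{n-1})$ for measurable maps $U_n\colon\mathcal{Y}^{n+1}\times\mathcal{I}^n\to\mathcal{I}$; adaptation happens only at the times $T_m$, i.e. $\Gamma_{i_1}=\Gamma_{i_2}$ whenever $i_1,i_2\in\{T_j,\dots,T_{j+1}-1\}$ for some $j$; and $\omega\mapsto\pi_{\Gamma_n(\omega)}(g)$ is measurable for every measurable $g\colon\mathcal{Y}\to\mathbb{R}$ with $\pi_\gamma(|g|)<\infty$ for all $\gamma$. Write $Y_n=(X_n,\phi_n)$ with $X_n\in\mathcal{X}$, $\phi_n\in\Phi$. Total variation distance: $\|\mu_1-\mu_2\|_{tv}=\inf_\xi\int\mathbf{1}_{\{x\neq y\}}\,\xi(dx,dy)=\sup_{A\in\mathcal{F}_\mathcal{Y}}|\mu_1(A)-\mu_2(A)|$, the infimum being over all couplings $\xi$ of $\mu_1,\mu_2$.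
   Formalization: The bound is proved for all n ≥ 2 rather than every n in ℕ: at n = 1 the right-hand side is (log 1)^{1/2+ε}·C = 0, which would force f(X_1) = ν(f) almost surely, false e.g. for i.i.d. uniform X_j on {0,1} with f(x) = x. *)

theory Defs
  imports "HOL-Probability.Probability"
begin

text \<open>A transition kernel on \<open>M\<close> is an element of \<open>M \<rightarrow>\<^sub>M prob_algebra M\<close>.  Its powers satisfy
  \<open>K^0(y, A) = 1_A(y)\<close> and \<open>K^(n+1)(y, A) = \<integral> K^n(z, A) K(y, dz)\<close>.\<close>

fun kernel_pow :: "'a measure \<Rightarrow> ('a \<Rightarrow> 'a measure) \<Rightarrow> nat \<Rightarrow> 'a \<Rightarrow> 'a measure" where
  "kernel_pow M K 0 y = return M y"
| "kernel_pow M K (Suc n) y = bind (K y) (kernel_pow M K n)"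

definition invariant_distribution :: "'a measure \<Rightarrow> ('a \<Rightarrow> 'a measure) \<Rightarrow> bool" where
  "invariant_distribution \<mu> K \<longleftrightarrow> bind \<mu> K = \<mu>"

definition irreducibility_measure :: "'a measure \<Rightarrow> ('a \<Rightarrow> 'a measure) \<Rightarrow> 'a measure \<Rightarrow> bool" where
  "irreducibility_measure M K \<phi> \<longleftrightarrow>
     sets \<phi> = sets M \<and> sigma_finite_measure \<phi> \<and> emeasure \<phi> (space \<phi>) \<noteq> 0 \<and>
     (\<forall>y\<in>space M. \<forall>A\<in>sets M. emeasure \<phi> A > 0 \<longrightarrow>
        (\<exists>n\<ge>1. emeasure (kernel_pow M K n y) A > 0))"

definition psi_irreducible :: "'a measure \<Rightarrow> ('a \<Rightarrow> 'a measure) \<Rightarrow> bool" where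
  "psi_irreducible M K \<longleftrightarrow> (\<exists>\<phi>. irreducibility_measure M K \<phi>)"

text \<open>As in Meyn and Tweedie, \<open>\<psi>\<close> denotes a maximal irreducibility measure, and periodicity is
  expressed by cycles that exhaust the state space up to a \<open>\<psi>\<close>-null set.  Note that
  \<open>absolutely_continuous \<psi> \<phi>\<close> says that \<open>\<phi>\<close> is absolutely continuous with respect to \<open>\<psi>\<close>.\<close>

definition maximal_irreducibility_measure ::
    "'a measure \<Rightarrow> ('a \<Rightarrow> 'a measure) \<Rightarrow> 'a measure \<Rightarrow> bool" where
  "maximal_irreducibility_measure M K \<psi> \<longleftrightarrow>
     irreducibility_measure M K \<psi> \<and>
     (\<forall>\<phi>. irreducibility_measure M K \<phi> \<longrightarrow> absolutely_continuous \<psi> \<phi>)"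

definition kernel_cycle ::
    "'a measure \<Rightarrow> ('a \<Rightarrow> 'a measure) \<Rightarrow> 'a measure \<Rightarrow> nat \<Rightarrow> (nat \<Rightarrow> 'a set) \<Rightarrow> bool" where
  "kernel_cycle M K \<psi> d D \<longleftrightarrow>
     (\<forall>i<d. D i \<in> sets M) \<and> disjoint_family_on D {..<d} \<and>
     (\<forall>i<d. \<forall>y\<in>D i. emeasure (K y) (D (Suc i mod d)) = 1) \<and>
     emeasure \<psi> (space M - (\<Union>i<d. D i)) = 0"

definition aperiodic_kernel :: "'a measure \<Rightarrow> ('a \<Rightarrow> 'a measure) \<Rightarrow> bool" where
  "aperiodic_kernel M K \<longleftrightarrow>
     \<not> (\<exists>\<psi> d D. maximal_irreducibility_measure M K \<psi> \<and> d \<ge> 2 \<and> kernel_cycle M K \<psi> d D)"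

text \<open>The normalisation is the one without factor 2: the supremum equals the infimum of
  \<open>\<xi>{(x, y). x \<noteq> y}\<close> over all couplings \<open>\<xi>\<close>.\<close>

definition tv_dist :: "'a measure \<Rightarrow> 'a measure \<Rightarrow> real" where
  "tv_dist \<mu>\<^sub>1 \<mu>\<^sub>2 = (SUP A\<in>sets \<mu>\<^sub>1. \<bar>measure \<mu>\<^sub>1 A - measure \<mu>\<^sub>2 A\<bar>)"

abbreviation state_space :: "('x::polish_space \<times> 'p::polish_space) measure" where
  "state_space \<equiv> borel \<Otimes>\<^sub>M borel"

definition mcmc_family ::
    "'x::polish_space measure \<Rightarrow> ('i::polish_space \<Rightarrow> ('x \<times> 'p::polish_space) measure) \<Rightarrow>
     ('i \<Rightarrow> 'x \<times> 'p \<Rightarrow> ('x \<times> 'p) measure) \<Rightarrow> bool" where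
  "mcmc_family \<nu> \<pi> P \<longleftrightarrow>
     \<nu> \<in> space (prob_algebra borel) \<and>
     (\<forall>\<gamma>. \<pi> \<gamma> \<in> space (prob_algebra state_space) \<and>
          (\<forall>B\<in>sets borel. emeasure (\<pi> \<gamma>) (B \<times> UNIV) = emeasure \<nu> B) \<and>
          P \<gamma> \<in> state_space \<rightarrow>\<^sub>M prob_algebra state_space \<and>
          invariant_distribution (\<pi> \<gamma>) (P \<gamma>) \<and>
          psi_irreducible state_space (P \<gamma>) \<and>
          aperiodic_kernel state_space (P \<gamma>)) \<and>
     (\<forall>A\<in>sets state_space.
        (\<lambda>(y, \<gamma>). measure (P \<gamma> y) A) \<in> borel_measurable (state_space \<Otimes>\<^sub>M borel))"

definition adapt_gap :: "real \<Rightarrow> nat \<Rightarrow> nat" where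
  "adapt_gap \<beta> j = nat \<lceil>real j powr \<beta>\<rceil>"

definition adapt_time :: "real \<Rightarrow> nat \<Rightarrow> nat" where
  "adapt_time \<beta> m = (\<Sum>j=1..m. adapt_gap \<beta> j)"

definition history ::
    "'w measure \<Rightarrow> (nat \<Rightarrow> 'w \<Rightarrow> 'x::polish_space \<times> 'p::polish_space) \<Rightarrow>
     (nat \<Rightarrow> 'w \<Rightarrow> 'i::polish_space) \<Rightarrow> nat \<Rightarrow> 'w measure" where
  "history M Y \<Gamma> n = sigma (space M)
     ({Y i -` B \<inter> space M | i B. i \<le> n \<and> B \<in> sets state_space} \<union>
      {\<Gamma> i -` B \<inter> space M | i B. i \<le> n \<and> B \<in> sets borel})"

definition air_chain ::
    "real \<Rightarrow> ('i::polish_space \<Rightarrow> ('x::polish_space \<times> 'p::polish_space) measure) \<Rightarrow>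
     ('i \<Rightarrow> 'x \<times> 'p \<Rightarrow> ('x \<times> 'p) measure) \<Rightarrow> 'x \<times> 'p \<Rightarrow> 'i \<Rightarrow> 'w measure \<Rightarrow>
     (nat \<Rightarrow> 'w \<Rightarrow> 'x \<times> 'p) \<Rightarrow> (nat \<Rightarrow> 'w \<Rightarrow> 'i) \<Rightarrow> bool" where
  "air_chain \<beta> \<pi> P y\<^sub>0 \<gamma>\<^sub>0 M Y \<Gamma> \<longleftrightarrow>
     \<beta> > 0 \<and> prob_space M \<and>
     (\<forall>n. Y n \<in> M \<rightarrow>\<^sub>M state_space) \<and> (\<forall>n. \<Gamma> n \<in> M \<rightarrow>\<^sub>M borel) \<and>
     (\<forall>\<omega>\<in>space M. Y 0 \<omega> = y\<^sub>0 \<and> \<Gamma> 0 \<omega> = \<gamma>\<^sub>0) \<and>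
     (\<forall>n. \<forall>B\<in>sets state_space. AE \<omega> in M.
        real_cond_exp M (history M Y \<Gamma> n) (indicator (Y (Suc n) -` B \<inter> space M)) \<omega>
          = measure (P (\<Gamma> n \<omega>) (Y n \<omega>)) B) \<and>
     (\<exists>U. \<forall>n. U n \<in> (Pi\<^sub>M {..n} (\<lambda>_. state_space)) \<Otimes>\<^sub>M (Pi\<^sub>M {..<n} (\<lambda>_. borel)) \<rightarrow>\<^sub>M borel \<and>
        (\<forall>\<omega>\<in>space M. \<Gamma> n \<omega> = U n (\<lambda>i\<in>{..n}. Y i \<omega>, \<lambda>i\<in>{..<n}. \<Gamma> i \<omega>))) \<and>
     (\<forall>j. \<forall>i\<^sub>1\<in>{adapt_time \<beta> j..<adapt_time \<beta> (Suc j)}.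
          \<forall>i\<^sub>2\<in>{adapt_time \<beta> j..<adapt_time \<beta> (Suc j)}. \<forall>\<omega>\<in>space M. \<Gamma> i\<^sub>1 \<omega> = \<Gamma> i\<^sub>2 \<omega>) \<and>
     (\<forall>g::'x \<times> 'p \<Rightarrow> real. g \<in> borel_measurable state_space \<longrightarrow> (\<forall>\<gamma>. integrable (\<pi> \<gamma>) g) \<longrightarrow>
        (\<forall>n. (\<lambda>\<omega>. \<integral>y. g y \<partial>\<pi> (\<Gamma> n \<omega>)) \<in> borel_measurable M))"

end

theory Submission
  imports Defs
begin

text \<open>Let \<open>g (x, \<phi>) = f x - \<nu>(f)\<close>.  Uniform geometric ergodicity makes \<open>G (y, \<gamma>) = (\<Sum>l. P\<^sub>\<gamma>\<^sup>l g y)\<close>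
  a bounded, jointly measurable solution of the Poisson equation \<open>g = G - P\<^sub>\<gamma> G\<close>.  Hence
  \<open>g (Y j) = (G (Y (j+1), \<Gamma> j) - P G (Y j, \<Gamma> j)) + (G (Y j, \<Gamma> j) - G (Y (j+1), \<Gamma> j))\<close>: the first bracket is a
  bounded martingale increment, and the second one telescopes except at adaptation times.  Since
  \<open>\<beta> \<ge> 1\<close>, there are only \<open>O(sqrt n)\<close> adaptation times up to \<open>n\<close>.  The Azuma--Hoeffding inequality and the
  Borel--Cantelli lemma bound the martingale by \<open>O(sqrt (n * ln n))\<close> almost surely, without any
  maximal inequality, and \<open>C\<close> is the supremum over \<open>n\<close> of the normalised averages.\<close>

section \<open>Total variation distance and integrals of bounded functions\<close>

lemma tv_dist_ge:
  assumes "prob_space \<mu>" "prob_space \<mu>'" "A \<in> sets \<mu>"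
  shows "\<bar>measure \<mu> A - measure \<mu>' A\<bar> \<le> tv_dist \<mu> \<mu>'"
  unfolding tv_dist_def
proof (rule cSUP_upper)
  interpret \<mu>: prob_space \<mu> by fact
  interpret \<mu>': prob_space \<mu>' by fact
  \<comment> \<open>A real supremum dominates its members only when the family is bounded above; 1
    is such a bound.\<close>
  have "\<bar>measure \<mu> A - measure \<mu>' A\<bar> \<le> 1" for A
    using \<mu>.prob_le_1[of A] \<mu>'.prob_le_1[of A] measure_nonneg[of \<mu> A] measure_nonneg[of \<mu>' A]
    by linarith
  then show "bdd_above ((\<lambda>A. \<bar>measure \<mu> A - measure \<mu>' A\<bar>) ` sets \<mu>)"
    by (intro bdd_aboveI2[where M = 1])
qed fact

text \<open>Counting the levels k \<le> t among 1, ..., N turns a function with values in [0, 1],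
  scaled by N, into a sum of indicators.\<close>

lemma sum_indicator_levels_eq_floor:
  assumes "0 \<le> t" "t \<le> real N"
  shows "(\<Sum>k=1..N. indicator {k. real k \<le> t} k) = real_of_int \<lfloor>t\<rfloor>"
proof -
  have "{1..N} \<inter> {k. real k \<le> t} = {1..nat \<lfloor>t\<rfloor>}"
    using assms by (auto simp: le_nat_iff le_floor_iff nat_le_iff floor_le_iff)
  then show ?thesis
    using assms by (simp add: indicator_def sum.If_cases)
qed

text \<open>A discrete layer-cake argument: up to 1/n, \<open>h\<close> is the average of the
  indicators of its level sets {h \<ge> k/n}. Each level set contributes at most
  \<open>tv_dist\<close> to the difference, and averaging keeps the constant 1 instead of the number
  of levels.\<close>

lemma integral_diff_le_tv_dist_unit:
  fixes h :: "'a \<Rightarrow> real"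
  assumes \<mu>: "prob_space \<mu>" and \<mu>': "prob_space \<mu>'" and sets: "sets \<mu>' = sets \<mu>"
    and h: "h \<in> borel_measurable \<mu>" and h01: "\<And>x. 0 \<le> h x" "\<And>x. h x \<le> 1"
  shows "\<bar>(\<integral>x. h x \<partial>\<mu>) - (\<integral>x. h x \<partial>\<mu>')\<bar> \<le> tv_dist \<mu> \<mu>'"
proof (rule field_le_epsilon)
  fix e :: real assume "0 < e"
  then obtain n where n: "2 / e < real n" using reals_Archimedean2 by blast
  have "0 < 2 / e" using \<open>0 < e\<close> by simp
  then have n0: "real n > 0" using n by linarith
  have ne: "2 / real n < e" using n n0 \<open>0 < e\<close> by (simp add: field_simps)
  define A where "A k = {x \<in> space \<mu>. real k \<le> real n * h x}" for k :: nat
  define s where "s x = (\<Sum>k=1..n. indicat_real (A k) x) / real n" for x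
  have A: "A k \<in> sets \<mu>" for k using h unfolding A_def by measurable
  have approx: "\<bar>h x - s x\<bar> \<le> 1 / real n" if "x \<in> space \<mu>" for x
  proof -
    have "s x = real_of_int \<lfloor>real n * h x\<rfloor> / real n"
      using that sum_indicator_levels_eq_floor[of "real n * h x" n] h01[of x] n0
      by (simp add: s_def A_def indicator_def mult_left_le)
    then have "h x - s x = (real n * h x - real_of_int \<lfloor>real n * h x\<rfloor>) / real n"
      using n0 by (simp add: diff_divide_distrib)
    moreover have "\<bar>real n * h x - real_of_int \<lfloor>real n * h x\<rfloor>\<bar> \<le> 1" by linarith
    ultimately show ?thesis using n0 by (simp add: divide_right_mono)
  qed
  \<comment> \<open>The level sets and n are fixed before the measure, so the same approximation
    serves both measures; the two errors add up to 2/n < e.\<close>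
  have *: "\<bar>(\<integral>x. h x \<partial>m) - (\<Sum>k=1..n. measure m (A k)) / real n\<bar> \<le> 1 / real n"
    if "prob_space m" and sm: "sets m = sets \<mu>" for m
  proof -
    interpret m: prob_space m by fact
    have [measurable]: "h \<in> borel_measurable m" "\<And>k. A k \<in> sets m"
      using h A by (simp_all add: sm cong: measurable_cong_sets)
    have sp: "space m = space \<mu>" by (rule sets_eq_imp_space_eq) fact
    have ih: "integrable m h"
      by (rule m.integrable_const_bound[where B = 1]) (use h01 in auto)
    have is': "integrable m s"
      unfolding s_def by (intro integrable_divide Bochner_Integration.integrable_sum) (auto simp: m.emeasure_finite less_top[symmetric])
    have "(\<integral>x. s x \<partial>m) = (\<Sum>k=1..n. measure m (A k)) / real n"
      unfolding s_def
      by (subst integral_divide_zero, subst Bochner_Integration.integral_sum)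
        (auto simp: m.emeasure_finite less_top[symmetric])
    then have "\<bar>(\<integral>x. h x \<partial>m) - (\<Sum>k=1..n. measure m (A k)) / real n\<bar> = \<bar>\<integral>x. h x - s x \<partial>m\<bar>"
      using ih is' by simp
    also have "\<dots> \<le> (\<integral>x. \<bar>h x - s x\<bar> \<partial>m)" by (rule integral_abs_bound)
    also have "\<dots> \<le> (\<integral>x. 1 / real n \<partial>m)"
      using ih is' approx by (intro integral_mono) (auto simp: sp)
    also have "\<dots> = 1 / real n" by (simp add: m.prob_space)
    finally show ?thesis .
  qed
  have "\<bar>(\<Sum>k=1..n. measure \<mu> (A k)) / real n - (\<Sum>k=1..n. measure \<mu>' (A k)) / real n\<bar>
      = \<bar>\<Sum>k=1..n. measure \<mu> (A k) - measure \<mu>' (A k)\<bar> / real n"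
    using n0 by (simp add: sum_subtractf diff_divide_distrib[symmetric])
  also have "\<dots> \<le> (\<Sum>k=1..n. \<bar>measure \<mu> (A k) - measure \<mu>' (A k)\<bar>) / real n"
    using n0 by (intro divide_right_mono sum_abs) auto
  also have "\<dots> \<le> (\<Sum>k=1..n. tv_dist \<mu> \<mu>') / real n"
    using n0 A by (intro divide_right_mono sum_mono tv_dist_ge \<mu> \<mu>') auto
  also have "\<dots> = tv_dist \<mu> \<mu>'" using n0 by simp
  finally have "\<bar>(\<Sum>k=1..n. measure \<mu> (A k)) / real n - (\<Sum>k=1..n. measure \<mu>' (A k)) / real n\<bar>
    \<le> tv_dist \<mu> \<mu>'" .
  moreover have "1 / real n + 1 / real n = 2 / real n" by simp
  ultimately show "\<bar>(\<integral>x. h x \<partial>\<mu>) - (\<integral>x. h x \<partial>\<mu>')\<bar> \<le> tv_dist \<mu> \<mu>' + e"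
    using *[OF \<mu> refl] *[OF \<mu>' sets] ne by linarith
qed

text \<open>The affine map from [-K, K] onto [0, 1] reduces this to the unit case, and
  \<open>2 * K\<close> is the length of the interval. The shift by 1/2 cancels because both measures
  have mass 1.\<close>

lemma integral_diff_le_tv_dist:
  fixes g :: "'a \<Rightarrow> real"
  assumes \<mu>: "prob_space \<mu>" and \<mu>': "prob_space \<mu>'" and sets: "sets \<mu>' = sets \<mu>"
    and g: "g \<in> borel_measurable \<mu>" and K: "\<And>x. \<bar>g x\<bar> \<le> K"
  shows "\<bar>(\<integral>x. g x \<partial>\<mu>) - (\<integral>x. g x \<partial>\<mu>')\<bar> \<le> 2 * K * tv_dist \<mu> \<mu>'"
proof (cases "K = 0")
  case True
  with K have "g = (\<lambda>_. 0)" by (auto simp: fun_eq_iff)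
  then show ?thesis using True by simp
next
  case False
  with K[of undefined] have K0: "K > 0" by linarith
  define h where "h x = g x / (2 * K) + 1 / 2" for x
  have h: "h \<in> borel_measurable \<mu>" using g unfolding h_def by measurable
  have h01: "0 \<le> h x" "h x \<le> 1" for x
    using K[of x] K0 by (auto simp: h_def field_simps abs_le_iff)
  have *: "(\<integral>x. h x \<partial>m) = (\<integral>x. g x \<partial>m) / (2 * K) + 1 / 2"
    if "prob_space m" and sm: "sets m = sets \<mu>" for m
  proof -
    interpret m: prob_space m by fact
    have "g \<in> borel_measurable m" using g by (simp add: sm cong: measurable_cong_sets)
    then have "integrable m g"
      by (intro m.integrable_const_bound[where B = K]) (use K in auto)
    then show ?thesis unfolding h_def by (simp add: m.prob_space)
  qed
  have "\<bar>(\<integral>x. g x \<partial>\<mu>) - (\<integral>x. g x \<partial>\<mu>')\<bar> / (2 * K) = \<bar>(\<integral>x. h x \<partial>\<mu>) - (\<integral>x. h x \<partial>\<mu>')\<bar>"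
    using K0 by (simp add: *[OF \<mu> refl] *[OF \<mu>' sets] diff_divide_distrib[symmetric])
  also have "\<dots> \<le> tv_dist \<mu> \<mu>'"
    by (rule integral_diff_le_tv_dist_unit[OF \<mu> \<mu>' sets h h01])
  finally show ?thesis using K0 by (simp add: field_simps)
qed

section \<open>Kernel powers and the Poisson equation\<close>

lemma measurable_kernel_pow:
  assumes P: "(\<lambda>(y, c). P c y) \<in> N \<Otimes>\<^sub>M I \<rightarrow>\<^sub>M prob_algebra N"
  shows "(\<lambda>(y, c). kernel_pow N (P c) l y) \<in> N \<Otimes>\<^sub>M I \<rightarrow>\<^sub>M prob_algebra N"
proof (induction l)
  case 0
  show ?case by simp
next
  case (Suc l)
  note [measurable] = Suc P
  \<comment> \<open>The parameter travels through the bind as \<open>snd x\<close>, because the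
    kernel being integrated depends on it as well as the integrating one.\<close>
  have "(\<lambda>x. (case x of (y, c) \<Rightarrow> P c y) \<bind> (\<lambda>z. case (z, snd x) of (z, c) \<Rightarrow> kernel_pow N (P c) l z))
      \<in> N \<Otimes>\<^sub>M I \<rightarrow>\<^sub>M prob_algebra N"
    by measurable
  then show ?case by (simp add: case_prod_beta')
qed

text \<open>Since \<open>g\<close> has mean 0 under every \<open>\<pi> c\<close>, its images under
  the kernel powers decay geometrically, so their sum converges; integrating against
  \<open>P c y\<close> shifts the series by one term. The bound \<open>D\<close> is uniform in
  \<open>c\<close>, which lets one function serve all parameters at once.\<close>

lemma poisson_equation_solution:
  fixes g :: "'a \<Rightarrow> real"
  assumes P: "(\<lambda>(y, c). P c y) \<in> N \<Otimes>\<^sub>M I \<rightarrow>\<^sub>M prob_algebra N"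
    and \<pi>: "\<And>c. c \<in> space I \<Longrightarrow> \<pi> c \<in> space (prob_algebra N)"
    and \<tau>: "0 \<le> \<tau>" "\<tau> < 1" and \<Lambda>: "0 \<le> \<Lambda>"
    and ergodic: "\<And>c y l. c \<in> space I \<Longrightarrow> y \<in> space N \<Longrightarrow> l \<ge> 1 \<Longrightarrow>
          tv_dist (kernel_pow N (P c) l y) (\<pi> c) \<le> \<Lambda> * \<tau> ^ l"
    and g: "g \<in> borel_measurable N" and K: "\<And>y. \<bar>g y\<bar> \<le> K"
    and centred: "\<And>c. c \<in> space I \<Longrightarrow> (\<integral>y. g y \<partial>\<pi> c) = 0"
  obtains G :: "'a \<times> 'c \<Rightarrow> real" and D :: real
  where "G \<in> borel_measurable (N \<Otimes>\<^sub>M I)"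
    and "\<And>y c. y \<in> space N \<Longrightarrow> c \<in> space I \<Longrightarrow> \<bar>G (y, c)\<bar> \<le> D"
    and "\<And>y c. y \<in> space N \<Longrightarrow> c \<in> space I \<Longrightarrow> g y = G (y, c) - (\<integral>z. G (z, c) \<partial>P c y)"
proof -
  define a where "a l x = (\<integral>z. g z \<partial>kernel_pow N (P (snd x)) l (fst x))" for l x
  define G where "G x = (\<Sum>l. a l x)" for x
  define B where "B = K + 2 * K * \<Lambda>"
  have K0: "K \<ge> 0" using K[of undefined] by linarith
  have kp: "kernel_pow N (P c) l y \<in> space (prob_algebra N)" if "y \<in> space N" "c \<in> space I" for y c l
    using measurable_space[OF measurable_kernel_pow[OF P, of l], of "(y, c)"] that
    by (simp add: space_pair_measure)
  have Pc: "P c \<in> N \<rightarrow>\<^sub>M prob_algebra N" if "c \<in> space I" for c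
    using measurable_compose[OF measurable_Pair2'[OF that, of N] P] by simp
  have kpc: "kernel_pow N (P c) l \<in> N \<rightarrow>\<^sub>M prob_algebra N" if "c \<in> space I" for c l
    using measurable_compose[OF measurable_Pair2'[OF that, of N] measurable_kernel_pow[OF P, of l]] by simp
  have a_meas [measurable]: "a l \<in> borel_measurable (N \<Otimes>\<^sub>M I)" for l
    using measurable_compose[OF measurable_prob_algebraD[OF measurable_kernel_pow[OF P, of l]]
        integral_measurable_subprob_algebra[OF g]]
    by (simp add: a_def[abs_def] case_prod_beta')
  have a0: "a 0 (y, c) = g y" if "y \<in> space N" for y c
    using that g by (simp add: a_def integral_return)
  \<comment> \<open>\<open>kernel_pow\<close> splits off the first step, so the power l + 1 applied
    to \<open>g\<close> is one step of the kernel applied to \<open>a l\<close>.\<close>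
  have aSuc: "a (Suc l) (y, c) = (\<integral>z. a l (z, c) \<partial>P c y)"
    if y: "y \<in> space N" and c: "c \<in> space I" for y c l
  proof -
    have "P c y \<in> space (prob_algebra N)" using measurable_space[OF Pc[OF c] y] .
    then interpret Py: prob_space "P c y" by (simp add: space_prob_algebra)
    have Ps: "sets (P c y) = sets N"
      using measurable_space[OF Pc[OF c] y] by (simp add: space_prob_algebra)
    have k: "kernel_pow N (P c) l \<in> P c y \<rightarrow>\<^sub>M subprob_algebra N"
      using measurable_prob_algebraD[OF kpc[OF c, of l]] by (simp add: Ps cong: measurable_cong_sets)
    have "AE z in P c y. emeasure (kernel_pow N (P c) l z) (space (kernel_pow N (P c) l z)) \<le> ennreal 1"
    proof (rule AE_I2)
      fix z assume "z \<in> space (P c y)"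
      then have "z \<in> space N" using sets_eq_imp_space_eq[OF Ps] by simp
      from kp[OF this c, of l] have "prob_space (kernel_pow N (P c) l z)"
        by (simp add: space_prob_algebra)
      then show "emeasure (kernel_pow N (P c) l z) (space (kernel_pow N (P c) l z)) \<le> ennreal 1"
        by (simp add: prob_space.emeasure_space_1)
    qed
    from integral_bind[OF g K k Py.finite_measure_axioms this]
    show ?thesis by (simp add: a_def)
  qed
  have a_bound: "\<bar>a l (y, c)\<bar> \<le> B * \<tau> ^ l" if y: "y \<in> space N" and c: "c \<in> space I" for l y c
  proof (cases "l = 0")
    case True
    then show ?thesis using a0[OF y, of c] K[of y] K0 \<Lambda> by (simp add: B_def)  (smt (verit) mult_nonneg_nonneg)
  next
    case False
    \<comment> \<open>Subtracting the vanishing mean under \<open>\<pi> c\<close> turns the term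
      into a difference of integrals, which total variation controls.\<close>
    have "\<bar>a l (y, c)\<bar> = \<bar>(\<integral>z. g z \<partial>kernel_pow N (P c) l y) - (\<integral>z. g z \<partial>\<pi> c)\<bar>"
      using centred[OF c] by (simp add: a_def)
    also have "\<dots> \<le> 2 * K * tv_dist (kernel_pow N (P c) l y) (\<pi> c)"
      using kp[OF y c, of l] \<pi>[OF c] g K
      by (intro integral_diff_le_tv_dist) (auto simp: space_prob_algebra cong: measurable_cong_sets)
    also have "\<dots> \<le> 2 * K * (\<Lambda> * \<tau> ^ l)"
      using ergodic[OF c y, of l] False K0 by (intro mult_left_mono) auto
    also have "\<dots> \<le> B * \<tau> ^ l"
      using K0 \<tau> by (simp add: B_def algebra_simps)
    finally show ?thesis .
  qed
  have summ: "summable (\<lambda>l. B * \<tau> ^ l)" using \<tau> by (intro summable_mult summable_geometric) simp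
  have suma: "summable (\<lambda>l. \<bar>a l (y, c)\<bar>)" if "y \<in> space N" "c \<in> space I" for y c
    using a_bound[OF that] by (intro summable_comparison_test'[OF summ]) auto
  show thesis
  proof (rule that)
    show "G \<in> borel_measurable (N \<Otimes>\<^sub>M I)" unfolding G_def by measurable
    fix y c assume y: "y \<in> space N" and c: "c \<in> space I"
    have "\<bar>G (y, c)\<bar> \<le> (\<Sum>l. \<bar>a l (y, c)\<bar>)"
      unfolding G_def using suma[OF y c] by (rule summable_rabs)
    also have "\<dots> \<le> (\<Sum>l. B * \<tau> ^ l)"
      by (intro suminf_le a_bound y c suma summ)
    finally show "\<bar>G (y, c)\<bar> \<le> (\<Sum>l. B * \<tau> ^ l)" .
    have Pin: "P c y \<in> space (prob_algebra N)" using measurable_space[OF Pc[OF c] y] .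
    then interpret Py: prob_space "P c y" by (simp add: space_prob_algebra)
    have Ps: "sets (P c y) = sets N" using Pin by (simp add: space_prob_algebra)
    have sp: "space (P c y) = space N" by (rule sets_eq_imp_space_eq[OF Ps])
    have am: "(\<lambda>z. a l (z, c)) \<in> borel_measurable (P c y)" for l
      using measurable_compose[OF measurable_Pair2'[OF c, of N] a_meas[of l]]
      by (simp add: Ps cong: measurable_cong_sets)
    have ai: "integrable (P c y) (\<lambda>z. a l (z, c))" for l
      using a_bound[OF _ c, of _ l] am
      by (intro Py.integrable_const_bound[where B = "B * \<tau> ^ l"]) (auto simp: sp)
    have int_le: "(\<integral>z. \<bar>a l (z, c)\<bar> \<partial>P c y) \<le> B * \<tau> ^ l" for l
    proof -
      have "(\<integral>z. \<bar>a l (z, c)\<bar> \<partial>P c y) \<le> (\<integral>z. B * \<tau> ^ l \<partial>P c y)"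
        using ai a_bound[OF _ c, of _ l] by (intro integral_mono) (auto simp: sp)
      then show ?thesis by (simp add: Py.prob_space)
    qed
    \<comment> \<open>The geometric bound justifies exchanging sum and integral; what remains is the
      series without its term of index 0, which is \<open>g y\<close>.\<close>
    have "(\<integral>z. G (z, c) \<partial>P c y) = (\<Sum>l. \<integral>z. a l (z, c) \<partial>P c y)"
      unfolding G_def
    proof (rule integral_suminf[OF ai])
      show "AE z in P c y. summable (\<lambda>l. norm (a l (z, c)))"
        using suma c by (intro AE_I2) (auto simp: sp)
      show "summable (\<lambda>l. \<integral>z. norm (a l (z, c)) \<partial>P c y)"
        using int_le by (intro summable_comparison_test'[OF summ]) auto
    qed
    also have "\<dots> = (\<Sum>l. a (Suc l) (y, c))" by (simp add: aSuc[OF y c])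
    also have "\<dots> = G (y, c) - a 0 (y, c)"
      unfolding G_def using suma[OF y c] by (intro suminf_split_head) (rule summable_rabs_cancel)
    finally show "g y = G (y, c) - (\<integral>z. G (z, c) \<partial>P c y)" using a0[OF y] by simp
  qed
qed

section \<open>Integration against a conditional law\<close>

text \<open>Freezing: given \<open>F\<close>, the variable \<open>Z\<close> may be integrated out against its conditional law while
  everything measurable with respect to \<open>F\<close> is held fixed.\<close>

lemma nn_integral_conditional_law:
  fixes v :: "'w \<times> 'a \<Rightarrow> ennreal"
  assumes M: "prob_space M" and F: "subalgebra M F" and Z: "Z \<in> M \<rightarrow>\<^sub>M N"
    and \<kappa>: "\<kappa> \<in> F \<rightarrow>\<^sub>M prob_algebra N"
    and cond: "\<And>B. B \<in> sets N \<Longrightarrow>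
          AE \<omega> in M. real_cond_exp M F (indicator (Z -` B \<inter> space M)) \<omega> = measure (\<kappa> \<omega>) B"
    and v: "v \<in> borel_measurable (F \<Otimes>\<^sub>M N)"
  shows "(\<integral>\<^sup>+\<omega>. v (\<omega>, Z \<omega>) \<partial>M) = (\<integral>\<^sup>+\<omega>. (\<integral>\<^sup>+z. v (\<omega>, z) \<partial>\<kappa> \<omega>) \<partial>M)"
proof -
  interpret M: prob_space M by fact
  interpret fin: finite_measure_subalgebra M F by unfold_locales fact
  have spF: "space F = space M" and setsF: "sets F \<subseteq> sets M"
    using F by (auto simp: subalgebra_def)
  \<comment> \<open>\<open>R\<close> is \<open>M\<close> seen on \<open>F\<close>, where
    \<open>\<kappa>\<close> is a kernel. With \<open>L\<close> keeping \<omega> and drawing the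
    second component from \<open>\<kappa> \<omega>\<close>, the measure \<open>R \<bind> L\<close>
    is the candidate for the joint law of \<omega> and \<open>Z \<omega>\<close>.\<close>
  define R where "R = restr_to_subalg M F"
  have sR: "sets R = sets F" unfolding R_def by (rule sets_restr_to_subalg[OF F])
  have spR: "space R = space M" unfolding R_def by (rule space_restr_to_subalg)
  have R: "R \<in> space (prob_algebra F)"
    using sR M.emeasure_space_1 emeasure_restr_to_subalg[OF F sets.top] spR spF
    by (auto simp: space_prob_algebra R_def intro!: prob_spaceI)
  have idF: "(\<lambda>\<omega>. \<omega>) \<in> M \<rightarrow>\<^sub>M F" using F by (auto simp: subalgebra_def intro!: measurableI)
  have \<kappa>D: "\<kappa> \<in> F \<rightarrow>\<^sub>M subprob_algebra N" using \<kappa> by (rule measurable_prob_algebraD)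
  have ZF: "(\<lambda>\<omega>. (\<omega>, Z \<omega>)) \<in> M \<rightarrow>\<^sub>M F \<Otimes>\<^sub>M N" using idF Z by (rule measurable_Pair)
  define L where "L \<omega> = distr (\<kappa> \<omega>) (F \<Otimes>\<^sub>M N) (\<lambda>z. (\<omega>, z))" for \<omega>
  have L: "L \<in> F \<rightarrow>\<^sub>M prob_algebra (F \<Otimes>\<^sub>M N)"
    unfolding L_def using \<kappa> by (rule measurable_distr_prob_space2) simp
  have LR: "L \<in> R \<rightarrow>\<^sub>M subprob_algebra (F \<Otimes>\<^sub>M N)"
    using measurable_prob_algebraD[OF L] by (simp add: sR cong: measurable_cong_sets)
  have \<kappa>s: "sets (\<kappa> \<omega>) = sets N" if "\<omega> \<in> space M" for \<omega>
    using measurable_space[OF \<kappa>, of \<omega>] that by (simp add: space_prob_algebra spF)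
  have pairm: "(\<lambda>z. (\<omega>, z)) \<in> \<kappa> \<omega> \<rightarrow>\<^sub>M F \<Otimes>\<^sub>M N" if "\<omega> \<in> space M" for \<omega>
    using that \<kappa>s[OF that] by (simp add: spF cong: measurable_cong_sets)
  \<comment> \<open>On a rectangle the claim is the defining property of conditional expectation:
    under an integral over \<open>A\<close> in \<open>F\<close>, the indicator of \<open>Z\<close>
    lying in \<open>B\<close> may be replaced by the mass that \<open>\<kappa>\<close> gives to
    \<open>B\<close>.\<close>
  have rect: "emeasure (distr M (F \<Otimes>\<^sub>M N) (\<lambda>\<omega>. (\<omega>, Z \<omega>))) (A \<times> B) = emeasure (R \<bind> L) (A \<times> B)"
    if A: "A \<in> sets F" and B: "B \<in> sets N" for A B
  proof -
    have AM: "A \<in> sets M" using A setsF by auto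
    have ZB: "Z -` B \<inter> space M \<in> sets M" using Z B by (rule measurable_sets)
    have mB: "(\<lambda>\<omega>. measure (\<kappa> \<omega>) B) \<in> borel_measurable F"
      using measurable_compose[OF \<kappa>D measurable_measure_subprob_algebra[OF B]] .
    then have mBM: "(\<lambda>\<omega>. measure (\<kappa> \<omega>) B) \<in> borel_measurable M"
      by (rule measurable_from_subalg[OF F])
    have le1: "measure (\<kappa> \<omega>) B \<le> 1" if "\<omega> \<in> space M" for \<omega>
      using measurable_space[OF \<kappa>, of \<omega>] that by (simp add: space_prob_algebra spF prob_space.prob_le_1)
    have int1: "integrable M (\<lambda>\<omega>. indicat_real A \<omega> * measure (\<kappa> \<omega>) B)"
      using mBM AM le1
      by (intro M.integrable_const_bound[where B = 1]) (auto simp: indicator_def)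
    have "measure M (A \<inter> (Z -` B \<inter> space M))
        = (\<integral>\<omega>\<in>A. indicat_real (Z -` B \<inter> space M) \<omega> \<partial>M)"
      using AM ZB by (simp add: set_lebesgue_integral_def indicator_inter_arith[symmetric])
    also have "\<dots> = (\<integral>\<omega>\<in>A. real_cond_exp M F (indicator (Z -` B \<inter> space M)) \<omega> \<partial>M)"
      using ZB A by (intro fin.real_cond_exp_intA) (auto simp: M.emeasure_finite less_top[symmetric])
    also have "\<dots> = (\<integral>\<omega>. indicat_real A \<omega> * measure (\<kappa> \<omega>) B \<partial>M)"
      unfolding set_lebesgue_integral_def using cond[OF B] AM mBM
      by (intro integral_cong_AE) auto
    finally have "emeasure M (A \<inter> (Z -` B \<inter> space M)) = ennreal (\<integral>\<omega>. indicat_real A \<omega> * measure (\<kappa> \<omega>) B \<partial>M)"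
      by (simp add: M.emeasure_eq_measure)
    also have "\<dots> = (\<integral>\<^sup>+\<omega>. ennreal (indicat_real A \<omega> * measure (\<kappa> \<omega>) B) \<partial>M)"
      using int1 by (subst nn_integral_eq_integral) auto
    also have "\<dots> = (\<integral>\<^sup>+\<omega>. emeasure (L \<omega>) (A \<times> B) \<partial>M)"
    proof (rule nn_integral_cong)
      fix \<omega> assume \<omega>: "\<omega> \<in> space M"
      interpret k: prob_space "\<kappa> \<omega>"
        using measurable_space[OF \<kappa>, of \<omega>] \<omega> by (simp add: space_prob_algebra spF)
      have "emeasure (L \<omega>) (A \<times> B) = emeasure (\<kappa> \<omega>) ((\<lambda>z. (\<omega>, z)) -` (A \<times> B) \<inter> space (\<kappa> \<omega>))"
        unfolding L_def using pairm[OF \<omega>] A B by (intro emeasure_distr) auto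
      also have "(\<lambda>z. (\<omega>, z)) -` (A \<times> B) \<inter> space (\<kappa> \<omega>) = (if \<omega> \<in> A then B else {})"
        using sets.sets_into_space[of B "\<kappa> \<omega>"] B \<kappa>s[OF \<omega>] by auto
      finally show "ennreal (indicat_real A \<omega> * measure (\<kappa> \<omega>) B) = emeasure (L \<omega>) (A \<times> B)"
        by (simp add: k.emeasure_eq_measure)
    qed
    also have "\<dots> = (\<integral>\<^sup>+\<omega>. emeasure (L \<omega>) (A \<times> B) \<partial>R)"
      unfolding R_def
    proof (rule nn_integral_subalgebra2[OF F, symmetric])
      show "(\<lambda>\<omega>. emeasure (L \<omega>) (A \<times> B)) \<in> borel_measurable F"
        using measurable_compose[OF measurable_prob_algebraD[OF L]
            measurable_emeasure_subprob_algebra[OF pair_measureI[OF A B]]] .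
    qed
    also have "\<dots> = emeasure (R \<bind> L) (A \<times> B)"
      using LR A B M.not_empty spR by (subst emeasure_bind) auto
    finally have "emeasure M (A \<inter> (Z -` B \<inter> space M)) = emeasure (R \<bind> L) (A \<times> B)" .
    moreover have "(\<lambda>\<omega>. (\<omega>, Z \<omega>)) -` (A \<times> B) \<inter> space M = A \<inter> (Z -` B \<inter> space M)" by auto
    ultimately show ?thesis using ZF A B by (subst emeasure_distr) auto
  qed
  \<comment> \<open>Rectangles form an intersection-stable generator and the total mass is finite,
    so agreement on them suffices.\<close>
  have "distr M (F \<Otimes>\<^sub>M N) (\<lambda>\<omega>. (\<omega>, Z \<omega>)) = R \<bind> L"
  proof (rule measure_eqI_generator_eq[OF Int_stable_pair_measure_generator[of F N],
        where \<Omega> = "space F \<times> space N" and A = "\<lambda>_. space F \<times> space N"])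
    show "{a \<times> b |a b. a \<in> sets F \<and> b \<in> sets N} \<subseteq> Pow (space F \<times> space N)"
      by (rule pair_measure_closed)
    show "sets (distr M (F \<Otimes>\<^sub>M N) (\<lambda>\<omega>. (\<omega>, Z \<omega>)))
        = sigma_sets (space F \<times> space N) {a \<times> b |a b. a \<in> sets F \<and> b \<in> sets N}"
      by (simp add: sets_pair_measure)
    show "sets (R \<bind> L) = sigma_sets (space F \<times> space N) {a \<times> b |a b. a \<in> sets F \<and> b \<in> sets N}"
      using LR M.not_empty spR by (subst sets_bind[OF sets_kernel[OF LR]]) (auto simp: sets_pair_measure)
    interpret d: prob_space "distr M (F \<Otimes>\<^sub>M N) (\<lambda>\<omega>. (\<omega>, Z \<omega>))" by (rule M.prob_space_distr[OF ZF])
    show "emeasure (distr M (F \<Otimes>\<^sub>M N) (\<lambda>\<omega>. (\<omega>, Z \<omega>))) (space F \<times> space N) \<noteq> \<infinity>"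
      by (simp add: d.emeasure_finite)
  qed (use rect in auto)
  then have "(\<integral>\<^sup>+x. v x \<partial>distr M (F \<Otimes>\<^sub>M N) (\<lambda>\<omega>. (\<omega>, Z \<omega>))) = (\<integral>\<^sup>+x. v x \<partial>(R \<bind> L))" by simp
  also have "\<dots> = (\<integral>\<^sup>+\<omega>. (\<integral>\<^sup>+x. v x \<partial>L \<omega>) \<partial>R)" by (rule nn_integral_bind[OF v LR])
  also have "\<dots> = (\<integral>\<^sup>+\<omega>. (\<integral>\<^sup>+x. v x \<partial>L \<omega>) \<partial>M)"
    unfolding R_def using measurable_compose[OF measurable_prob_algebraD[OF L]
        nn_integral_measurable_subprob_algebra[OF v]]
    by (rule nn_integral_subalgebra2[OF F])
  also have "\<dots> = (\<integral>\<^sup>+\<omega>. (\<integral>\<^sup>+z. v (\<omega>, z) \<partial>\<kappa> \<omega>) \<partial>M)"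
    unfolding L_def using pairm v by (intro nn_integral_cong) (simp add: nn_integral_distr)
  finally show ?thesis using ZF v by (simp add: nn_integral_distr)
qed

section \<open>The Azuma-Hoeffding inequality and its almost sure consequence\<close>

text \<open>After freezing, \<open>S\<close> is constant and its exponential factors out.
  Hoeffding's lemma for a centred variable in an interval of length 2 * c gives exp (l^2 * (2 * c)^2
  / 8), which is the stated factor.\<close>

lemma exp_moment_conditional_step:
  fixes S :: "'w \<Rightarrow> real" and h :: "'w \<times> 'a \<Rightarrow> real"
  assumes M: "prob_space M" and F: "subalgebra M F" and Z: "Z \<in> M \<rightarrow>\<^sub>M N"
    and \<kappa>: "\<kappa> \<in> F \<rightarrow>\<^sub>M prob_algebra N"
    and cond: "\<And>B. B \<in> sets N \<Longrightarrow>
          AE \<omega> in M. real_cond_exp M F (indicator (Z -` B \<inter> space M)) \<omega> = measure (\<kappa> \<omega>) B"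
    and S: "S \<in> borel_measurable F" and h: "h \<in> borel_measurable (F \<Otimes>\<^sub>M N)"
    and bound: "\<And>\<omega> z. \<omega> \<in> space M \<Longrightarrow> z \<in> space N \<Longrightarrow> \<bar>h (\<omega>, z)\<bar> \<le> c"
    and centred: "\<And>\<omega>. \<omega> \<in> space M \<Longrightarrow> (\<integral>z. h (\<omega>, z) \<partial>\<kappa> \<omega>) = 0"
    and l: "0 < l"
  shows "(\<integral>\<^sup>+\<omega>. ennreal (exp (l * (S \<omega> + h (\<omega>, Z \<omega>)))) \<partial>M)
      \<le> ennreal (exp (l\<^sup>2 * c\<^sup>2 / 2)) * (\<integral>\<^sup>+\<omega>. ennreal (exp (l * S \<omega>)) \<partial>M)"
proof -
  have spF: "space F = space M" using F by (auto simp: subalgebra_def)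
  note [measurable] = S h
  have SM [measurable]: "S \<in> borel_measurable M" by (rule measurable_from_subalg[OF F S])
  have "(\<integral>\<^sup>+\<omega>. ennreal (exp (l * (S \<omega> + h (\<omega>, Z \<omega>)))) \<partial>M)
      = (\<integral>\<^sup>+\<omega>. (\<integral>\<^sup>+z. ennreal (exp (l * (S \<omega> + h (\<omega>, z)))) \<partial>\<kappa> \<omega>) \<partial>M)"
    using nn_integral_conditional_law[OF M F Z \<kappa> cond,
        of "\<lambda>x. ennreal (exp (l * (S (fst x) + h x)))"] by simp
  also have "\<dots> \<le> (\<integral>\<^sup>+\<omega>. ennreal (exp (l\<^sup>2 * c\<^sup>2 / 2)) * ennreal (exp (l * S \<omega>)) \<partial>M)"
  proof (rule nn_integral_mono)
    fix \<omega> assume \<omega>: "\<omega> \<in> space M"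
    have \<kappa>\<omega>: "prob_space (\<kappa> \<omega>)" "sets (\<kappa> \<omega>) = sets N"
      using measurable_space[OF \<kappa>, of \<omega>] \<omega> by (simp_all add: space_prob_algebra spF)
    have hm [measurable]: "(\<lambda>z. h (\<omega>, z)) \<in> borel_measurable (\<kappa> \<omega>)"
      using measurable_compose[OF measurable_Pair1' h, of \<omega>] \<omega> \<kappa>\<omega>(2)
      by (simp add: spF cong: measurable_cong_sets)
    have "interval_bounded_random_variable (\<kappa> \<omega>) (\<lambda>z. h (\<omega>, z)) (- c) c"
      using \<kappa>\<omega> bound[OF \<omega>] sets_eq_imp_space_eq[OF \<kappa>\<omega>(2)]
      by (auto simp: interval_bounded_random_variable_def interval_bounded_random_variable_axioms_def
          abs_le_iff minus_le_iff intro!: AE_I2)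
    from interval_bounded_random_variable.Hoeffdings_lemma_nn_integral_0[OF this l centred[OF \<omega>]]
    have H: "(\<integral>\<^sup>+z. ennreal (exp (l * h (\<omega>, z))) \<partial>\<kappa> \<omega>) \<le> ennreal (exp (l\<^sup>2 * c\<^sup>2 / 2))"
      by (simp add: power2_eq_square mult_ac)
    have "(\<integral>\<^sup>+z. ennreal (exp (l * (S \<omega> + h (\<omega>, z)))) \<partial>\<kappa> \<omega>)
        = (\<integral>\<^sup>+z. ennreal (exp (l * S \<omega>)) * ennreal (exp (l * h (\<omega>, z))) \<partial>\<kappa> \<omega>)"
      by (simp add: distrib_left exp_add ennreal_mult)
    also have "\<dots> = ennreal (exp (l * S \<omega>)) * (\<integral>\<^sup>+z. ennreal (exp (l * h (\<omega>, z))) \<partial>\<kappa> \<omega>)"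
      by (rule nn_integral_cmult) measurable
    also have "\<dots> \<le> ennreal (exp (l * S \<omega>)) * ennreal (exp (l\<^sup>2 * c\<^sup>2 / 2))"
      using H by (rule mult_left_mono) simp
    finally show "(\<integral>\<^sup>+z. ennreal (exp (l * (S \<omega> + h (\<omega>, z)))) \<partial>\<kappa> \<omega>)
        \<le> ennreal (exp (l\<^sup>2 * c\<^sup>2 / 2)) * ennreal (exp (l * S \<omega>))" by (simp add: mult.commute)
  qed
  also have "\<dots> = ennreal (exp (l\<^sup>2 * c\<^sup>2 / 2)) * (\<integral>\<^sup>+\<omega>. ennreal (exp (l * S \<omega>)) \<partial>M)"
    by (rule nn_integral_cmult) measurable
  finally show ?thesis .
qed

text \<open>Azuma's argument: peeling off the last increment costs one factor, since the partial sum
  before it is known to \<open>F n\<close>. The increment is a function of the past and the fresh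
  variable \<open>Z n\<close>, so centring is an integral identity for every \<omega> instead of an
  almost sure statement about conditional expectations.\<close>

lemma exp_moment_sum_conditionally_centred:
  fixes h :: "nat \<Rightarrow> 'w \<times> 'a \<Rightarrow> real"
  assumes M: "prob_space M" and F: "\<And>n. subalgebra M (F n)" and Z: "\<And>n. Z n \<in> M \<rightarrow>\<^sub>M N"
    and \<kappa>: "\<And>n. \<kappa> n \<in> F n \<rightarrow>\<^sub>M prob_algebra N"
    and cond: "\<And>n B. B \<in> sets N \<Longrightarrow>
          AE \<omega> in M. real_cond_exp M (F n) (indicator (Z n -` B \<inter> space M)) \<omega> = measure (\<kappa> n \<omega>) B"
    and h: "\<And>n. h n \<in> borel_measurable (F n \<Otimes>\<^sub>M N)"
    and adapted: "\<And>n. (\<lambda>\<omega>. \<Sum>j<n. h j (\<omega>, Z j \<omega>)) \<in> borel_measurable (F n)"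
    and bound: "\<And>n \<omega> z. \<omega> \<in> space M \<Longrightarrow> z \<in> space N \<Longrightarrow> \<bar>h n (\<omega>, z)\<bar> \<le> c"
    and centred: "\<And>n \<omega>. \<omega> \<in> space M \<Longrightarrow> (\<integral>z. h n (\<omega>, z) \<partial>\<kappa> n \<omega>) = 0"
    and l: "0 < l"
  shows "(\<integral>\<^sup>+\<omega>. ennreal (exp (l * (\<Sum>j<n. h j (\<omega>, Z j \<omega>)))) \<partial>M) \<le> ennreal (exp (real n * (l\<^sup>2 * c\<^sup>2 / 2)))"
proof (induction n)
  case 0
  show ?case using M by (simp add: prob_space.emeasure_space_1)
next
  case (Suc n)
  have "(\<integral>\<^sup>+\<omega>. ennreal (exp (l * (\<Sum>j<Suc n. h j (\<omega>, Z j \<omega>)))) \<partial>M)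
      \<le> ennreal (exp (l\<^sup>2 * c\<^sup>2 / 2)) * (\<integral>\<^sup>+\<omega>. ennreal (exp (l * (\<Sum>j<n. h j (\<omega>, Z j \<omega>)))) \<partial>M)"
    using exp_moment_conditional_step[OF M F Z \<kappa> cond[where n = n] adapted h
        bound[where n = n] centred[where n = n] l] by simp
  also have "\<dots> \<le> ennreal (exp (l\<^sup>2 * c\<^sup>2 / 2)) * ennreal (exp (real n * (l\<^sup>2 * c\<^sup>2 / 2)))"
    using Suc by (rule mult_left_mono) simp
  also have "\<dots> = ennreal (exp (real (Suc n) * (l\<^sup>2 * c\<^sup>2 / 2)))"
    by (simp add: ennreal_mult[symmetric] exp_add[symmetric] algebra_simps add_divide_distrib)
  finally show ?case .
qed

text \<open>Optimising the Chernoff bound over \<open>l\<close> at the level \<open>2 * c * sqrt (n * ln n)\<close> gives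
  \<open>l = 2 * sqrt (ln n / n) / c\<close> and the tail \<open>n\<close> to the power \<open>-2\<close>.\<close>

lemma subgaussian_tail:
  fixes S :: "'w \<Rightarrow> real"
  assumes M: "prob_space M" and S: "S \<in> borel_measurable M" and c: "0 < c" and n: "2 \<le> n"
    and mgf: "\<And>l. 0 < l \<Longrightarrow>
          (\<integral>\<^sup>+\<omega>. ennreal (exp (l * S \<omega>)) \<partial>M) \<le> ennreal (exp (real n * (l\<^sup>2 * c\<^sup>2 / 2)))"
  shows "measure M {\<omega> \<in> space M. S \<omega> \<ge> 2 * c * sqrt (real n * ln (real n))} \<le> 1 / (real n)\<^sup>2"
proof -
  interpret prob_space M by fact
  define L where "L = ln (real n)"
  have L: "L > 0" using n by (simp add: L_def)
  define l where "l = 2 * sqrt (L / real n) / c"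
  have l: "0 < l" using L n c by (simp add: l_def)
  have lt: "l * (2 * c * sqrt (real n * L)) = 4 * L"
    using c n L by (simp add: l_def real_sqrt_mult real_sqrt_divide)
  have l2: "real n * (l\<^sup>2 * c\<^sup>2 / 2) = 2 * L"
    using c n L by (simp add: l_def power_mult_distrib power_divide)
  have "emeasure M {\<omega> \<in> space M. S \<omega> \<ge> 2 * c * sqrt (real n * L)}
      \<le> ennreal (exp (- l * (2 * c * sqrt (real n * L)))) *
          (\<integral>\<^sup>+\<omega>. ennreal (exp (l * S \<omega>)) * indicator (space M) \<omega> \<partial>M)"
    using S by (intro Chernoff_ineq_nn_integral_ge l) auto
  also have "(\<integral>\<^sup>+\<omega>. ennreal (exp (l * S \<omega>)) * indicator (space M) \<omega> \<partial>M) = (\<integral>\<^sup>+\<omega>. ennreal (exp (l * S \<omega>)) \<partial>M)"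
    by (intro nn_integral_cong) simp
  also have "ennreal (exp (- l * (2 * c * sqrt (real n * L)))) * (\<integral>\<^sup>+\<omega>. ennreal (exp (l * S \<omega>)) \<partial>M)
      \<le> ennreal (exp (- (4 * L))) * ennreal (exp (2 * L))"
    using mgf[OF l] lt l2 by (intro mult_mono) (auto simp: minus_mult_left[symmetric])
  also have "\<dots> = ennreal (exp (- 2 * L))"
    by (simp add: ennreal_mult[symmetric] exp_add[symmetric])
  also have "exp (- 2 * L) = 1 / (real n)\<^sup>2"
    using n by (simp add: L_def exp_minus exp_double field_simps)
  finally show ?thesis by (simp add: emeasure_eq_measure L_def)
qed

text \<open>For n \<ge> 2 each of the two tails at this level has probability at most 1 / n^2. These
  are summable, so by Borel-Cantelli almost every path exceeds the level only finitely
  often.\<close>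

lemma AE_eventually_sum_conditionally_centred_le:
  fixes h :: "nat \<Rightarrow> 'w \<times> 'a \<Rightarrow> real"
  assumes M: "prob_space M" and F: "\<And>n. subalgebra M (F n)" and Z: "\<And>n. Z n \<in> M \<rightarrow>\<^sub>M N"
    and \<kappa>: "\<And>n. \<kappa> n \<in> F n \<rightarrow>\<^sub>M prob_algebra N"
    and cond: "\<And>n B. B \<in> sets N \<Longrightarrow>
          AE \<omega> in M. real_cond_exp M (F n) (indicator (Z n -` B \<inter> space M)) \<omega> = measure (\<kappa> n \<omega>) B"
    and h: "\<And>n. h n \<in> borel_measurable (F n \<Otimes>\<^sub>M N)"
    and adapted: "\<And>n. (\<lambda>\<omega>. \<Sum>j<n. h j (\<omega>, Z j \<omega>)) \<in> borel_measurable (F n)"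
    and bound: "\<And>n \<omega> z. \<omega> \<in> space M \<Longrightarrow> z \<in> space N \<Longrightarrow> \<bar>h n (\<omega>, z)\<bar> \<le> c"
    and centred: "\<And>n \<omega>. \<omega> \<in> space M \<Longrightarrow> (\<integral>z. h n (\<omega>, z) \<partial>\<kappa> n \<omega>) = 0"
    and c: "0 < c"
  shows "AE \<omega> in M. eventually
           (\<lambda>n. \<bar>\<Sum>j<n. h j (\<omega>, Z j \<omega>)\<bar> \<le> 2 * c * sqrt (real n * ln (real n))) sequentially"
proof -
  interpret prob_space M by fact
  define S where "S n \<omega> = (\<Sum>j<n. h j (\<omega>, Z j \<omega>))" for n \<omega>
  define t where "t n = 2 * c * sqrt (real n * ln (real n))" for n
  have S [measurable]: "S n \<in> borel_measurable M" for n
    using measurable_from_subalg[OF F adapted[of n]] by (simp add: S_def[abs_def])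
  have mgf: "(\<integral>\<^sup>+\<omega>. ennreal (exp (l * S n \<omega>)) \<partial>M) \<le> ennreal (exp (real n * (l\<^sup>2 * c\<^sup>2 / 2)))"
    if "0 < l" for l n
    unfolding S_def using exp_moment_sum_conditionally_centred[OF M F Z \<kappa> cond h adapted bound centred that] .
  \<comment> \<open>The lower tail is the upper tail of \<open>- S n\<close>, and the negated
    increments satisfy the same hypotheses.\<close>
  have mgf': "(\<integral>\<^sup>+\<omega>. ennreal (exp (l * - S n \<omega>)) \<partial>M) \<le> ennreal (exp (real n * (l\<^sup>2 * c\<^sup>2 / 2)))"
    if "0 < l" for l n
    unfolding S_def sum_negf[symmetric]
  proof (rule exp_moment_sum_conditionally_centred[OF M F Z \<kappa> cond, where h = "\<lambda>j x. - h j x"])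
    show "(\<lambda>x. - h n x) \<in> borel_measurable (F n \<Otimes>\<^sub>M N)" for n using h[of n] by measurable
    show "(\<lambda>\<omega>. \<Sum>j<n. - h j (\<omega>, Z j \<omega>)) \<in> borel_measurable (F n)" for n
      using adapted[of n] by (simp add: sum_negf)
  qed (use bound centred that in auto)
  \<comment> \<open>For n < 2 the level \<open>t n\<close> is 0 and the tail estimate does not
    apply; leaving out two indices does not affect an eventual statement.\<close>
  define A where "A n = (if n < 2 then {} else {\<omega> \<in> space M. S n \<omega> \<ge> t n} \<union> {\<omega> \<in> space M. - S n \<omega> \<ge> t n})" for n
  have A: "A n \<in> sets M" for n unfolding A_def by simp
  have "measure M (A n) \<le> 2 * (1 / (real n)\<^sup>2)" for n
  proof (cases "n < 2")
    case False
    have "measure M (A n) \<le> measure M {\<omega> \<in> space M. S n \<omega> \<ge> t n} + measure M {\<omega> \<in> space M. - S n \<omega> \<ge> t n}"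
      using False by (simp add: A_def measure_Un_le)
    also have "\<dots> \<le> 1 / (real n)\<^sup>2 + 1 / (real n)\<^sup>2"
      using False unfolding t_def
      by (intro add_mono subgaussian_tail[OF M _ c] mgf mgf') auto
    finally show ?thesis by simp
  qed (simp add: A_def)
  then have "norm (measure M (A n)) \<le> 2 * (1 / (real n)\<^sup>2)" for n by simp
  moreover have "summable (\<lambda>n. 2 * (1 / (real n)\<^sup>2))"
    using inverse_power_summable[of 2, where 'a = real] by (intro summable_mult) (simp add: inverse_eq_divide)
  ultimately have "summable (\<lambda>n. measure M (A n))"
    by (rule summable_comparison_test'[of _ 0, rotated])
  then have "AE \<omega> in M. eventually (\<lambda>n. \<omega> \<in> space M - A n) sequentially"
    using A by (intro borel_cantelli_AE1) (auto simp: emeasure_finite less_top[symmetric])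
  then show ?thesis
  proof eventually_elim
    case (elim \<omega>)
    then show ?case using eventually_ge_at_top[of 2]
      by eventually_elim (auto simp: A_def S_def t_def)
  qed
qed

section \<open>From an eventual bound to a random constant\<close>

text \<open>An eventual bound leaves finitely many other terms, so the supremum is finite almost
  surely. Taking it in \<open>ennreal\<close> makes it measurable without a case distinction; where
  it is infinite, \<open>enn2real\<close> returns 0.\<close>

lemma AE_bounded_by_measurable:
  fixes r :: "nat \<Rightarrow> 'w \<Rightarrow> real"
  assumes [measurable]: "\<And>n. r n \<in> borel_measurable M"
    and ev: "AE \<omega> in M. eventually (\<lambda>n. r n \<omega> \<le> K) sequentially"
  obtains C where "C \<in> borel_measurable M" and "AE \<omega> in M. \<forall>n. r n \<omega> \<le> C \<omega>"
proof
  show "(\<lambda>\<omega>. enn2real (SUP n. ennreal (r n \<omega>))) \<in> borel_measurable M" by measurable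
  show "AE \<omega> in M. \<forall>n. r n \<omega> \<le> enn2real (SUP n. ennreal (r n \<omega>))"
    using ev
  proof eventually_elim
    case (elim \<omega>)
    then obtain m where m: "\<And>n. n \<ge> m \<Longrightarrow> r n \<omega> \<le> K" by (auto simp: eventually_sequentially)
    define B where "B = Max (insert K ((\<lambda>n. r n \<omega>) ` {..<m}))"
    have "r n \<omega> \<le> B" for n
    proof (cases "n < m")
      case True
      then show ?thesis unfolding B_def by (intro Max_ge) auto
    next
      case False
      then have "r n \<omega> \<le> K" using m by simp
      also have "K \<le> B" unfolding B_def by (intro Max_ge) auto
      finally show ?thesis .
    qed
    then have "(SUP n. ennreal (r n \<omega>)) \<le> ennreal B" by (intro SUP_least ennreal_leI)
    also have "\<dots> < \<infinity>" by simp
    finally have fin: "(SUP n. ennreal (r n \<omega>)) < top" by simp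
    show ?case
    proof
      fix n
      have "ennreal (r n \<omega>) \<le> (SUP n. ennreal (r n \<omega>))" by (rule SUP_upper) simp
      then have "enn2real (ennreal (r n \<omega>)) \<le> enn2real (SUP n. ennreal (r n \<omega>))"
        using fin by (rule enn2real_mono)
      \<comment> \<open>\<open>ennreal\<close> truncates negative values to 0; for those the claim
        holds because the right-hand side is nonnegative.\<close>
      then show "r n \<omega> \<le> enn2real (SUP n. ennreal (r n \<omega>))"
        by (cases "r n \<omega> \<ge> 0") (auto intro: order_trans[OF _ enn2real_nonneg])
    qed
  qed
qed

section \<open>Telescoping between adaptation times\<close>

text \<open>\<open>E j\<close> stands for the value at the next state under the old parameter, so
  the sum telescopes wherever the parameter is kept. A parameter change costs at most
  \<open>2 * D\<close>, and the quadratic growth of \<open>T\<close> allows at most sqrt (2 * (n +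
  1)) of them; the other \<open>2 * D\<close> pays for the two boundary terms.\<close>

lemma block_telescoping_bound:
  fixes G E :: "nat \<Rightarrow> real"
  assumes T0: "T 0 = 0" and T: "strict_mono T" and growth: "\<And>m. m * m \<le> 2 * T m"
    and GD: "\<And>j. \<bar>G j\<bar> \<le> D" and ED: "\<And>j. \<bar>E j\<bar> \<le> D"
    and match: "\<And>j m. T m \<le> j \<Longrightarrow> Suc j < T (Suc m) \<Longrightarrow> E j = G (Suc j)"
  shows "\<bar>\<Sum>j=1..n. G j - E j\<bar> \<le> 2 * D + 2 * D * sqrt (2 * real (Suc n))"
proof -
  define k where "k = nat \<lfloor>sqrt (2 * real (Suc n))\<rfloor>"
  \<comment> \<open>\<open>E j\<close> can differ from \<open>G (Suc j)\<close> only if time j + 1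
    opens a new block.\<close>
  define J where "J = {j \<in> {1..n}. Suc j \<in> range T}"
  have D0: "D \<ge> 0" using GD[of 0] by linarith
  have off: "E j = G (Suc j)" if "Suc j \<notin> range T" for j
  proof -
    \<comment> \<open>This locates the block of \<open>j\<close>: \<open>T 0 = 0\<close> excludes m
      = 0, and minimality gives T m' \<le> j. As j + 1 is no adaptation time, it lies in the same
      block.\<close>
    define m where "m = (LEAST m. j < T m)"
    have ex: "j < T (Suc j)" using strict_mono_imp_increasing[OF T, of "Suc j"] by simp
    have jm: "j < T m" unfolding m_def using ex by (rule LeastI)
    then obtain m' where m': "m = Suc m'" using T0 by (cases m) auto
    have "\<not> j < T m'" using not_less_Least[of m' "\<lambda>m. j < T m"] m' by (simp add: m_def)
    moreover have "Suc j < T (Suc m')" using jm that m' by (metis Suc_lessI rangeI)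
    ultimately show ?thesis using match[of m' j] by simp
  qed
  have "J \<subseteq> (\<lambda>m. T m - 1) ` {1..k}"
  proof
    fix j assume "j \<in> J"
    then obtain m where m: "Suc j = T m" and jn: "j \<le> n" by (auto simp: J_def)
    have "m \<noteq> 0" using m T0 by (cases m) auto
    have "m * m \<le> 2 * Suc j" using growth[of m] m by simp
    also have "\<dots> \<le> 2 * Suc n" using jn by simp
    finally have "m * m \<le> 2 * Suc n" .
    then have "(real m)\<^sup>2 \<le> 2 * real (Suc n)"
      unfolding power2_eq_square by (metis of_nat_le_iff of_nat_mult of_nat_numeral)
    then have "real m \<le> sqrt (2 * real (Suc n))" by (rule real_le_rsqrt)
    then have "m \<le> k" unfolding k_def by (simp add: le_nat_floor)
    then show "j \<in> (\<lambda>m. T m - 1) ` {1..k}" using m \<open>m \<noteq> 0\<close> by (intro image_eqI[of _ _ m]) auto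
  qed
  then have "card J \<le> card ((\<lambda>m. T m - 1) ` {1..k})" by (intro card_mono) auto
  also have "\<dots> \<le> k" using card_image_le[of "{1..k}" "\<lambda>m. T m - 1"] by simp
  finally have "real (card J) \<le> real k" by simp
  also have "real k \<le> sqrt (2 * real (Suc n))" unfolding k_def by (rule of_nat_floor) simp
  finally have cJ: "real (card J) \<le> sqrt (2 * real (Suc n))" .
  have "(\<Sum>j=1..n. G j - E j) = (\<Sum>j=1..n. G j - G (Suc j)) + (\<Sum>j=1..n. G (Suc j) - E j)"
    by (simp add: sum.distrib[symmetric])
  also have "(\<Sum>j=1..n. G j - G (Suc j)) = G 1 - G (Suc n)"
    by (induction n) auto
  finally have eq: "(\<Sum>j=1..n. G j - E j) = (G 1 - G (Suc n)) + (\<Sum>j=1..n. G (Suc j) - E j)" .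
  have "\<bar>\<Sum>j=1..n. G (Suc j) - E j\<bar> = \<bar>\<Sum>j\<in>J. G (Suc j) - E j\<bar>"
    by (intro arg_cong[where f = abs] sum.mono_neutral_right) (auto simp: J_def off)
  also have "\<dots> \<le> (\<Sum>j\<in>J. \<bar>G (Suc j) - E j\<bar>)" by (rule sum_abs)
  also have "\<dots> \<le> (\<Sum>j\<in>J. 2 * D)"
  proof (rule sum_mono)
    show "\<bar>G (Suc j) - E j\<bar> \<le> 2 * D" for j using GD[of "Suc j"] ED[of j] by linarith
  qed
  also have "\<dots> \<le> 2 * D * sqrt (2 * real (Suc n))"
    using mult_left_mono[OF cJ, of "2 * D"] D0 by (simp add: mult.commute)
  finally show ?thesis unfolding eq using GD[of 1] GD[of "Suc n"] by linarith
qed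

lemma adapt_time_0: "adapt_time \<beta> 0 = 0"
  by (simp add: adapt_time_def)

text \<open>This is where \<open>\<beta> \<ge> 1\<close> enters; the growth of the adaptation times
  below rests on it.\<close>

lemma adapt_gap_ge:
  assumes "\<beta> \<ge> 1"
  shows "j \<le> adapt_gap \<beta> j"
proof (cases "j = 0")
  case False
  then have "real j powr 1 \<le> real j powr \<beta>" using assms by (intro powr_mono) auto
  then have "real j \<le> real j powr \<beta>" using False by simp
  also have "\<dots> \<le> real_of_int \<lceil>real j powr \<beta>\<rceil>" by simp
  finally have "int j \<le> \<lceil>real j powr \<beta>\<rceil>" by linarith
  then show ?thesis by (simp add: adapt_gap_def nat_le_iff le_nat_iff)
qed simp

lemma adapt_time_Suc_ge:
  assumes "\<beta> \<ge> 1"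
  shows "adapt_time \<beta> m + Suc m \<le> adapt_time \<beta> (Suc m)"
  using adapt_gap_ge[OF assms, of "Suc m"] by (simp add: adapt_time_def)

lemma strict_mono_adapt_time:
  assumes "\<beta> \<ge> 1"
  shows "strict_mono (adapt_time \<beta>)"
  unfolding strict_mono_Suc_iff
proof
  show "adapt_time \<beta> m < adapt_time \<beta> (Suc m)" for m
    using adapt_time_Suc_ge[OF assms, of m] by simp
qed

text \<open>The first m gaps dominate 1, ..., m, and twice the sum of these is m * (m + 1).\<close>

lemma adapt_time_quadratic_growth:
  assumes "\<beta> \<ge> 1"
  shows "m * m \<le> 2 * adapt_time \<beta> m"
proof (induction m)
  case (Suc m)
  then show ?case using adapt_time_Suc_ge[OF assms, of m] by simp
qed simp

section \<open>The history filtration and the kernel family\<close>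

lemma subalgebra_history:
  assumes "\<And>i. Y i \<in> M \<rightarrow>\<^sub>M state_space" and "\<And>i. \<Gamma> i \<in> M \<rightarrow>\<^sub>M borel"
  shows "subalgebra M (history M Y \<Gamma> n)"
proof -
  let ?E = "{Y i -` B \<inter> space M | i B. i \<le> n \<and> B \<in> sets state_space} \<union>
      {\<Gamma> i -` B \<inter> space M | i B. i \<le> n \<and> B \<in> sets borel}"
  have "?E \<subseteq> sets M" using measurable_sets[OF assms(1)] measurable_sets[OF assms(2)] by blast
  then have "sigma_sets (space M) ?E \<subseteq> sets M" by (rule sets.sigma_sets_subset)
  moreover have "sets (sigma (space M) ?E) = sigma_sets (space M) ?E" by (rule sets_measure_of) blast
  ultimately show ?thesis by (simp add: subalgebra_def history_def space_measure_of_conv)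
qed

lemma measurable_history_state:
  assumes "Y i \<in> M \<rightarrow>\<^sub>M state_space" and "i \<le> n"
  shows "Y i \<in> history M Y \<Gamma> n \<rightarrow>\<^sub>M state_space"
proof (rule measurableI)
  have sp: "space (history M Y \<Gamma> n) = space M" by (simp add: history_def space_measure_of_conv)
  show "x \<in> space (history M Y \<Gamma> n) \<Longrightarrow> Y i x \<in> space state_space" for x
    by (simp add: space_pair_measure)
  fix B assume "B \<in> sets (state_space :: ('b \<times> 'c) measure)"
  then have "Y i -` B \<inter> space M \<in> {Y i -` B \<inter> space M | i B. i \<le> n \<and> B \<in> sets state_space} \<union>
      {\<Gamma> i -` B \<inter> space M | i B. i \<le> n \<and> B \<in> sets borel}"
    using assms(2) by blast
  then show "Y i -` B \<inter> space (history M Y \<Gamma> n) \<in> sets (history M Y \<Gamma> n)"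
    unfolding sp by (unfold history_def, intro in_measure_of) auto
qed

lemma measurable_history_parameter:
  assumes "i \<le> n"
  shows "\<Gamma> i \<in> history M Y \<Gamma> n \<rightarrow>\<^sub>M borel"
proof (rule measurableI)
  have sp: "space (history M Y \<Gamma> n) = space M" by (simp add: history_def space_measure_of_conv)
  fix B :: "'b set" assume "B \<in> sets borel"
  then have "\<Gamma> i -` B \<inter> space M \<in> {Y i -` B \<inter> space M | i B. i \<le> n \<and> B \<in> sets state_space} \<union>
      {\<Gamma> i -` B \<inter> space M | i B. i \<le> n \<and> B \<in> sets borel}"
    using assms by blast
  then show "\<Gamma> i -` B \<inter> space (history M Y \<Gamma> n) \<in> sets (history M Y \<Gamma> n)"
    unfolding sp by (unfold history_def, intro in_measure_of) auto
qed simp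

text \<open>The setting gives joint measurability for one set at a time. The \<sigma>-algebra on the
  space of measures is generated by these evaluations, so the statements combine into one kernel on
  states and parameters.\<close>

lemma mcmc_family_measurable_kernel:
  assumes "mcmc_family \<nu> \<pi> P"
  shows "(\<lambda>(y, c). P c y) \<in> state_space \<Otimes>\<^sub>M borel \<rightarrow>\<^sub>M prob_algebra state_space"
proof (rule measurable_prob_algebraI)
  have P: "P c y \<in> space (prob_algebra state_space)" for c y
  proof -
    have "P c \<in> state_space \<rightarrow>\<^sub>M prob_algebra state_space"
      using assms unfolding mcmc_family_def by blast
    from measurable_space[OF this, of y] show ?thesis by (simp add: space_pair_measure)
  qed
  show pr: "prob_space (case x of (y, c) \<Rightarrow> P c y)" for x
    using P by (auto simp: space_prob_algebra split: prod.split)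
  show "(\<lambda>(y, c). P c y) \<in> state_space \<Otimes>\<^sub>M borel \<rightarrow>\<^sub>M subprob_algebra state_space"
  proof (rule measurable_subprob_algebra)
    show "subprob_space (case x of (y, c) \<Rightarrow> P c y)" for x
      using pr by (rule prob_space_imp_subprob_space)
    show "sets (case x of (y, c) \<Rightarrow> P c y) = sets state_space" for x
      using P by (auto simp: space_prob_algebra split: prod.split)
    fix A assume "A \<in> sets (state_space :: ('a \<times> 'c) measure)"
    then have "(\<lambda>(y, c). measure (P c y) A) \<in> borel_measurable (state_space \<Otimes>\<^sub>M borel)"
      using assms unfolding mcmc_family_def by blast
    then have "(\<lambda>x. ennreal (measure (case x of (y, c) \<Rightarrow> P c y) A)) \<in> borel_measurable (state_space \<Otimes>\<^sub>M borel)"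
      by (simp add: case_prod_beta')
    then show "(\<lambda>x. emeasure (case x of (y, c) \<Rightarrow> P c y) A) \<in> borel_measurable (state_space \<Otimes>\<^sub>M borel)"
      using pr by (simp add: finite_measure.emeasure_eq_measure[OF prob_space.finite_measure])
  qed
qed

text \<open>All the measures \<open>\<pi> c\<close> share the first marginal \<nu>. Hence one
  centring constant suits the whole chain even though its invariant distribution moves with the
  parameter.\<close>

lemma mcmc_family_integral_fst:
  fixes f :: "'x::polish_space \<Rightarrow> real"
  assumes fam: "mcmc_family \<nu> \<pi> P" and f: "f \<in> borel_measurable borel"
  shows "(\<integral>y. f (fst y) \<partial>\<pi> c) = (\<integral>x. f x \<partial>\<nu>)"
proof -
  have "\<pi> c \<in> space (prob_algebra state_space)" and "\<nu> \<in> space (prob_algebra borel)"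
    and B: "\<And>B. B \<in> sets borel \<Longrightarrow> emeasure (\<pi> c) (B \<times> UNIV) = emeasure \<nu> B"
    using fam unfolding mcmc_family_def by blast+
  then have s\<pi>: "sets (\<pi> c) = sets state_space" and s\<nu>: "sets \<nu> = sets borel"
    by (simp_all add: space_prob_algebra)
  have sp: "space (\<pi> c) = UNIV" using sets_eq_imp_space_eq[OF s\<pi>] by (simp add: space_pair_measure)
  have m: "fst \<in> \<pi> c \<rightarrow>\<^sub>M borel" by (simp add: s\<pi> cong: measurable_cong_sets)
  have "distr (\<pi> c) borel fst = \<nu>"
  proof (rule measure_eqI)
    fix A assume "A \<in> sets (distr (\<pi> c) borel fst)"
    then have A: "A \<in> sets borel" by simp
    have "fst -` A \<inter> space (\<pi> c) = A \<times> UNIV" by (auto simp: sp)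
    then show "emeasure (distr (\<pi> c) borel fst) A = emeasure \<nu> A"
      using A B[OF A] m by (simp add: emeasure_distr)
  qed (simp add: s\<nu>)
  then show ?thesis using integral_distr[OF m f] by simp
qed

section \<open>The convergence rate along the AIR chain\<close>

text \<open>The range starts at n = 2: at n = 1 the power of the logarithm is 0, whereas the
  left-hand side may be positive.\<close>

theorem corollary4p5:
  fixes \<nu> :: "'x::polish_space measure"
    and \<pi> :: "'i::polish_space \<Rightarrow> ('x \<times> 'p::polish_space) measure"
    and P :: "'i \<Rightarrow> 'x \<times> 'p \<Rightarrow> ('x \<times> 'p) measure"
    and M :: "'w measure"
    and Y :: "nat \<Rightarrow> 'w \<Rightarrow> 'x \<times> 'p"
    and \<Gamma> :: "nat \<Rightarrow> 'w \<Rightarrow> 'i"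
    and y\<^sub>0 :: "'x \<times> 'p" and \<gamma>\<^sub>0 :: 'i
    and \<beta> \<tau> \<Lambda> \<epsilon> :: real
    and f :: "'x \<Rightarrow> real"
  assumes "mcmc_family \<nu> \<pi> P"
    and "air_chain \<beta> \<pi> P y\<^sub>0 \<gamma>\<^sub>0 M Y \<Gamma>"
    and "\<beta> \<ge> 1"
    and "0 \<le> \<tau>" "\<tau> < 1" "0 < \<Lambda>"
    and "\<And>\<gamma> y l. l \<ge> 1 \<Longrightarrow>
           tv_dist (kernel_pow state_space (P \<gamma>) l y) (\<pi> \<gamma>) \<le> \<Lambda> * \<tau> ^ l"
    and "f \<in> borel_measurable borel" and "bounded (range f)"
    and "\<epsilon> > 0"
  shows "\<exists>C \<in> borel_measurable M. AE \<omega> in M. \<forall>n::nat. n \<ge> 2 \<longrightarrow>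
           \<bar>1 / real n * (\<Sum>j=1..n. f (fst (Y j \<omega>)) - (\<integral>x. f x \<partial>\<nu>))\<bar>
             \<le> ln (real n) powr (1 / 2 + \<epsilon>) / sqrt (real n) * C \<omega>"
proof -
  note fam = assms(1) and chain = assms(2) and \<beta> = assms(3)
  interpret M: prob_space M using chain by (simp add: air_chain_def)
  have Y: "Y n \<in> M \<rightarrow>\<^sub>M state_space" and \<Gamma>: "\<Gamma> n \<in> M \<rightarrow>\<^sub>M borel" for n
    using chain by (auto simp: air_chain_def)
  have cond: "AE \<omega> in M. real_cond_exp M (history M Y \<Gamma> n) (indicator (Y (Suc n) -` B \<inter> space M)) \<omega>
      = measure (P (\<Gamma> n \<omega>) (Y n \<omega>)) B" if "B \<in> sets state_space" for n B
    using chain that by (simp add: air_chain_def)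
  have const_on_block: "\<Gamma> i\<^sub>1 \<omega> = \<Gamma> i\<^sub>2 \<omega>"
    if "i\<^sub>1 \<in> {adapt_time \<beta> j..<adapt_time \<beta> (Suc j)}" "i\<^sub>2 \<in> {adapt_time \<beta> j..<adapt_time \<beta> (Suc j)}"
      "\<omega> \<in> space M" for i\<^sub>1 i\<^sub>2 j \<omega>
    using chain that unfolding air_chain_def by blast
  have kernel: "(\<lambda>(y, c). P c y) \<in> state_space \<Otimes>\<^sub>M borel \<rightarrow>\<^sub>M prob_algebra state_space"
    using fam by (rule mcmc_family_measurable_kernel)

  define g where "g y = f (fst y) - (\<integral>x. f x \<partial>\<nu>)" for y :: "'x \<times> 'p"
  have g: "g \<in> borel_measurable state_space"
    unfolding g_def using assms(8) by measurable
  obtain K0 where K0: "\<And>x. \<bar>f x\<bar> \<le> K0" using assms(9) by (auto simp: bounded_iff)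
  define K where "K = K0 + \<bar>\<integral>x. f x \<partial>\<nu>\<bar>"
  have K: "\<bar>g y\<bar> \<le> K" for y using K0[of "fst y"] unfolding g_def K_def by linarith
  have \<pi>: "\<pi> c \<in> space (prob_algebra state_space)" for c using fam by (simp add: mcmc_family_def)
  have centred: "(\<integral>y. g y \<partial>\<pi> c) = 0" for c
  proof -
    interpret p: prob_space "\<pi> c" using \<pi>[of c] by (simp add: space_prob_algebra)
    have "(\<lambda>y. f (fst y)) \<in> borel_measurable (\<pi> c)"
      using \<pi>[of c] assms(8) by (simp add: space_prob_algebra cong: measurable_cong_sets)
    then have "integrable (\<pi> c) (\<lambda>y. f (fst y))"
      using K0 by (intro p.integrable_const_bound[where B = K0]) auto
    then show ?thesis
      unfolding g_def using mcmc_family_integral_fst[OF fam assms(8)] by (simp add: p.prob_space)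
  qed
  obtain G D where G: "G \<in> borel_measurable (state_space \<Otimes>\<^sub>M borel)"
    and GD: "\<And>y c. \<bar>G (y, c)\<bar> \<le> D" and poisson: "\<And>y c. g y = G (y, c) - (\<integral>z. G (z, c) \<partial>P c y)"
    using poisson_equation_solution[OF kernel \<pi> assms(4,5) less_imp_le[OF assms(6)] assms(7) g K centred]
    by (auto simp: space_pair_measure)
  have D0: "0 \<le> D" using GD[of undefined undefined] by linarith

  text \<open>Everything is shifted by one because the sum in the theorem starts at time \<open>1\<close>: \<open>h n\<close> is the
    martingale increment revealed at time \<open>n + 2\<close>.\<close>

  define F where "F n = history M Y \<Gamma> (Suc n)" for n
  define Z where "Z n = Y (Suc (Suc n))" for n
  define \<kappa> where "\<kappa> n \<omega> = P (\<Gamma> (Suc n) \<omega>) (Y (Suc n) \<omega>)" for n \<omega>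
  define h where "h n x = G (snd x, \<Gamma> (Suc n) (fst x)) - (G (Y (Suc n) (fst x), \<Gamma> (Suc n) (fst x)) - g (Y (Suc n) (fst x)))" for n x
  have F: "subalgebra M (F n)" for n unfolding F_def by (rule subalgebra_history[OF Y \<Gamma>])
  have spF: "space (F n) = space M" for n using F[of n] by (simp add: subalgebra_def)
  have YF: "Y i \<in> F n \<rightarrow>\<^sub>M state_space" and \<Gamma>F: "\<Gamma> i \<in> F n \<rightarrow>\<^sub>M borel" if "i \<le> Suc n" for i n
    unfolding F_def using that Y by (auto intro: measurable_history_state measurable_history_parameter)
  have \<kappa>: "\<kappa> n \<in> F n \<rightarrow>\<^sub>M prob_algebra state_space" for n
    using measurable_compose[OF measurable_Pair[OF YF \<Gamma>F] kernel, of "Suc n" n "Suc n"]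
    by (simp add: \<kappa>_def[abs_def])
  note [measurable] = G g
  have h: "h n \<in> borel_measurable (F n \<Otimes>\<^sub>M state_space)" for n
  proof -
    note [measurable] = YF[of "Suc n" n, OF order_refl] \<Gamma>F[of "Suc n" n, OF order_refl]
    show ?thesis unfolding h_def[abs_def] by measurable
  qed
  have adapted: "(\<lambda>\<omega>. \<Sum>j<n. h j (\<omega>, Z j \<omega>)) \<in> borel_measurable (F n)" for n
  proof (rule borel_measurable_sum)
    fix j assume "j \<in> {..<n}"
    then have le: "Suc j \<le> Suc n" "Suc (Suc j) \<le> Suc n" by auto
    note [measurable] = YF[OF le(1)] YF[OF le(2)] \<Gamma>F[OF le(1)]
    show "(\<lambda>\<omega>. h j (\<omega>, Z j \<omega>)) \<in> borel_measurable (F n)"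
      unfolding h_def Z_def by simp
  qed
  \<comment> \<open>The Poisson equation read backwards: \<open>h\<close> carries the integral of
    \<open>G\<close> under the kernel in the form G - g, whose measurability with respect to the
    history is immediate.\<close>
  have inner: "(\<integral>z. G (z, \<Gamma> (Suc n) \<omega>) \<partial>\<kappa> n \<omega>) = G (Y (Suc n) \<omega>, \<Gamma> (Suc n) \<omega>) - g (Y (Suc n) \<omega>)" for n \<omega>
    using poisson[of "Y (Suc n) \<omega>" "\<Gamma> (Suc n) \<omega>"] by (simp add: \<kappa>_def)
  have \<kappa>_facts: "prob_space (\<kappa> n \<omega>)" "integrable (\<kappa> n \<omega>) (\<lambda>z. G (z, \<Gamma> (Suc n) \<omega>))"
    if "\<omega> \<in> space M" for n \<omega>
  proof -
    have k: "prob_space (\<kappa> n \<omega>)" "sets (\<kappa> n \<omega>) = sets state_space"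
      using measurable_space[OF \<kappa>[of n], of \<omega>] that by (simp_all add: spF space_prob_algebra)
    then show "prob_space (\<kappa> n \<omega>)" by simp
    interpret k: prob_space "\<kappa> n \<omega>" by fact
    have "(\<lambda>z. G (z, \<Gamma> (Suc n) \<omega>)) \<in> borel_measurable (\<kappa> n \<omega>)"
      using k(2) by (simp cong: measurable_cong_sets)
    then show "integrable (\<kappa> n \<omega>) (\<lambda>z. G (z, \<Gamma> (Suc n) \<omega>))"
      using GD by (intro k.integrable_const_bound[where B = D]) auto
  qed
  have h_centred: "(\<integral>z. h n (\<omega>, z) \<partial>\<kappa> n \<omega>) = 0" if "\<omega> \<in> space M" for n \<omega>
  proof -
    interpret k: prob_space "\<kappa> n \<omega>" using \<kappa>_facts[OF that] by blast
    show ?thesis using \<kappa>_facts(2)[OF that, of n] inner[of n \<omega>] by (simp add: h_def k.prob_space)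
  qed
  \<comment> \<open>Estimating G - g as an average of \<open>G\<close> yields \<open>D\<close> again
    rather than D + K.\<close>
  have inner_bound: "\<bar>G (Y (Suc n) \<omega>, \<Gamma> (Suc n) \<omega>) - g (Y (Suc n) \<omega>)\<bar> \<le> D" if "\<omega> \<in> space M" for n \<omega>
  proof -
    interpret k: prob_space "\<kappa> n \<omega>" using \<kappa>_facts[OF that] by blast
    have "\<bar>\<integral>z. G (z, \<Gamma> (Suc n) \<omega>) \<partial>\<kappa> n \<omega>\<bar> \<le> (\<integral>z. \<bar>G (z, \<Gamma> (Suc n) \<omega>)\<bar> \<partial>\<kappa> n \<omega>)"
      by (rule integral_abs_bound)
    also have "\<dots> \<le> (\<integral>z. D \<partial>\<kappa> n \<omega>)"
      using \<kappa>_facts(2)[OF that, of n] GD by (intro integral_mono) auto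
    finally show ?thesis by (simp add: inner k.prob_space)
  qed
  \<comment> \<open>The increment is bounded by 2 * D; adding 1 keeps the constant positive when D =
    0, as the choice of l in the tail bound divides by it.\<close>
  have h_bound: "\<bar>h n (\<omega>, z)\<bar> \<le> 2 * D + 1" if "\<omega> \<in> space M" for n \<omega> z
    using inner_bound[OF that, of n] GD[of z "\<Gamma> (Suc n) \<omega>"] unfolding h_def fst_conv snd_conv by linarith

  have martingale: "AE \<omega> in M. eventually (\<lambda>n. \<bar>\<Sum>j<n. h j (\<omega>, Z j \<omega>)\<bar>
      \<le> 2 * (2 * D + 1) * sqrt (real n * ln (real n))) sequentially"
  proof (rule AE_eventually_sum_conditionally_centred_le[OF M.prob_space_axioms F _ \<kappa> _ h adapted h_bound h_centred])
    show "Z n \<in> M \<rightarrow>\<^sub>M state_space" for n unfolding Z_def by (rule Y)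
    show "AE \<omega> in M. real_cond_exp M (F n) (indicator (Z n -` B \<inter> space M)) \<omega> = measure (\<kappa> n \<omega>) B"
      if "B \<in> sets state_space" for n B
      unfolding F_def Z_def \<kappa>_def using that by (rule cond)
  qed (use D0 in auto)

  have blocks: "\<bar>\<Sum>j=1..n. g (Y j \<omega>)\<bar> \<le> \<bar>\<Sum>j<n. h j (\<omega>, Z j \<omega>)\<bar> + 2 * D + 2 * D * sqrt (2 * real (Suc n))"
    if \<omega>: "\<omega> \<in> space M" for \<omega> n
  proof -
    have "(\<Sum>j<n. h j (\<omega>, Z j \<omega>))
        = (\<Sum>j=1..n. G (Y (Suc j) \<omega>, \<Gamma> j \<omega>) - (G (Y j \<omega>, \<Gamma> j \<omega>) - g (Y j \<omega>)))"
      by (simp add: sum.atLeast1_atMost_eq h_def Z_def)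
    then have eq: "(\<Sum>j=1..n. g (Y j \<omega>)) = (\<Sum>j<n. h j (\<omega>, Z j \<omega>))
        + (\<Sum>j=1..n. G (Y j \<omega>, \<Gamma> j \<omega>) - G (Y (Suc j) \<omega>, \<Gamma> j \<omega>))"
      by (simp add: sum.distrib[symmetric])
    have "\<bar>\<Sum>j=1..n. G (Y j \<omega>, \<Gamma> j \<omega>) - G (Y (Suc j) \<omega>, \<Gamma> j \<omega>)\<bar> \<le> 2 * D + 2 * D * sqrt (2 * real (Suc n))"
    proof (rule block_telescoping_bound[where T = "adapt_time \<beta>"])
      fix j m assume "adapt_time \<beta> m \<le> j" "Suc j < adapt_time \<beta> (Suc m)"
      then have "\<Gamma> j \<omega> = \<Gamma> (Suc j) \<omega>" using \<omega> by (intro const_on_block[of _ m]) auto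
      then show "G (Y (Suc j) \<omega>, \<Gamma> j \<omega>) = G (Y (Suc j) \<omega>, \<Gamma> (Suc j) \<omega>)" by simp
    qed (use \<beta> GD in \<open>auto simp: adapt_time_0 strict_mono_adapt_time adapt_time_quadratic_growth\<close>)
    then show ?thesis unfolding eq by linarith
  qed

  define w where "w n = ln (real n) powr (1 / 2 + \<epsilon>) / sqrt (real n)" for n :: nat
  \<comment> \<open>\<open>w 0\<close> and \<open>w 1\<close> are 0, so \<open>r 0\<close> and
    \<open>r 1\<close> are 0 by the convention for division by 0 and contribute nothing to the
    supremum.\<close>
  define r where "r n \<omega> = \<bar>1 / real n * (\<Sum>j=1..n. g (Y j \<omega>))\<bar> / w n" for n \<omega>
  \<comment> \<open>The summand \<open>2 * (2 * D + 1)\<close> comes from the martingale and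
    \<open>6 * D\<close> from the telescoping remainder.\<close>
  have r_eventually: "AE \<omega> in M. eventually (\<lambda>n. r n \<omega> \<le> 2 * (2 * D + 1) + 6 * D) sequentially"
    using martingale AE_space
  proof eventually_elim
    case (elim \<omega>)
    show ?case using elim(1) eventually_ge_at_top[of 3]
    proof eventually_elim
      case (elim n)
      have n: "real n \<ge> 3" using elim(2) by simp
      define L where "L = ln (real n)"
      \<comment> \<open>From n = 3 on the logarithm is at least 1. Its exponent may then be raised
        from 1/2 to 1/2 + \<epsilon>, and the remainder of order sqrt n may be multiplied by sqrt
        L.\<close>
      have "exp 1 \<le> real n" using exp_le n by linarith
      then have L: "1 \<le> L" unfolding L_def using n by (subst ln_ge_iff) auto
      have "sqrt L = L powr (1 / 2)" using L by (simp add: powr_half_sqrt)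
      also have "\<dots> \<le> L powr (1 / 2 + \<epsilon>)" using L assms(10) by (intro powr_mono) auto
      finally have L\<epsilon>: "sqrt L \<le> L powr (1 / 2 + \<epsilon>)" .
      have sL: "1 \<le> sqrt L" using L by simp
      have sn: "1 \<le> sqrt (real n)" using n by simp
      \<comment> \<open>The boundary terms cost at most 2 * D * sqrt n and the parameter changes at
        most 4 * D * sqrt n, which gives the 6 * D.\<close>
      have "sqrt (2 * real (Suc n)) \<le> sqrt (4 * real n)" using n by (intro real_sqrt_le_mono) simp
      also have "\<dots> = 2 * sqrt (real n)" by (simp add: real_sqrt_mult)
      finally have "2 * D + 2 * D * sqrt (2 * real (Suc n)) \<le> 2 * D * sqrt (real n) + 2 * D * (2 * sqrt (real n))"
        using D0 sn mult_left_mono[OF sn, of "2 * D"] by (intro add_mono mult_left_mono) auto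
      also have "\<dots> = 6 * D * sqrt (real n) * 1" by simp
      also have "\<dots> \<le> 6 * D * sqrt (real n) * sqrt L" using D0 sL by (intro mult_left_mono) auto
      finally have rest: "2 * D + 2 * D * sqrt (2 * real (Suc n)) \<le> 6 * D * sqrt (real n) * sqrt L" .
      have "\<bar>\<Sum>j=1..n. g (Y j \<omega>)\<bar> \<le> 2 * (2 * D + 1) * sqrt (real n * L) + 6 * D * sqrt (real n) * sqrt L"
        using blocks[OF \<open>\<omega> \<in> space M\<close>, of n] elim(1) rest unfolding L_def by linarith
      also have "\<dots> = (2 * (2 * D + 1) + 6 * D) * sqrt (real n) * sqrt L"
        by (simp add: real_sqrt_mult algebra_simps)
      also have "\<dots> \<le> (2 * (2 * D + 1) + 6 * D) * sqrt (real n) * L powr (1 / 2 + \<epsilon>)"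
        using D0 L\<epsilon> by (intro mult_left_mono) auto
      finally have "\<bar>\<Sum>j=1..n. g (Y j \<omega>)\<bar> / real n
          \<le> (2 * (2 * D + 1) + 6 * D) * sqrt (real n) * L powr (1 / 2 + \<epsilon>) / real n"
        using n by (intro divide_right_mono) auto
      also have "\<dots> = (2 * (2 * D + 1) + 6 * D) * w n"
      proof -
        have "sqrt (real n) / real n = 1 / sqrt (real n)"
          using real_div_sqrt[of "real n"] n by (simp add: field_simps)
        then have "a * sqrt (real n) * b / real n = a * (b / sqrt (real n))" for a b
          by (metis mult.assoc mult.commute mult.right_neutral times_divide_eq_right)
        then show ?thesis unfolding w_def L_def .
      qed
      finally have "\<bar>1 / real n * (\<Sum>j=1..n. g (Y j \<omega>))\<bar> \<le> (2 * (2 * D + 1) + 6 * D) * w n"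
        by (simp add: abs_mult)
      moreover have "w n > 0" using n L by (simp add: w_def L_def)
      ultimately show ?case unfolding r_def by (subst pos_divide_le_eq)
    qed
  qed
  have r_measurable: "r n \<in> borel_measurable M" for n
  proof -
    note [measurable] = Y
    show ?thesis unfolding r_def[abs_def] by measurable
  qed
  obtain C where C: "C \<in> borel_measurable M" "AE \<omega> in M. \<forall>n. r n \<omega> \<le> C \<omega>"
    by (rule AE_bounded_by_measurable[OF r_measurable r_eventually])
  have wpos: "w n > 0" if "n \<ge> 2" for n using that by (simp add: w_def)
  from C(2) have "AE \<omega> in M. \<forall>n::nat. n \<ge> 2 \<longrightarrow>
      \<bar>1 / real n * (\<Sum>j=1..n. f (fst (Y j \<omega>)) - (\<integral>x. f x \<partial>\<nu>))\<bar> \<le> w n * C \<omega>"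
  proof eventually_elim
    case (elim \<omega>)
    show ?case
    proof (intro allI impI)
      fix n :: nat assume "n \<ge> 2"
      from elim[rule_format, of n] show "\<bar>1 / real n * (\<Sum>j=1..n. f (fst (Y j \<omega>)) - (\<integral>x. f x \<partial>\<nu>))\<bar> \<le> w n * C \<omega>"
        unfolding r_def g_def pos_divide_le_eq[OF wpos[OF \<open>n \<ge> 2\<close>]] by (simp only: mult.commute)
    qed
  qed
  then show ?thesis using C(1) unfolding w_def by blast
qed

end
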